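(* The fibrational semantics is complete: for the given base category $\mathfrak{C}$, an object $t$ of $\mathfrak{C}$ and contexts $\Gamma:t$ and $\Delta:t$, if $[\![\Gamma]\!]_t\le[\![\Delta]\!]_t$ (in every model fibration over $\mathfrak{C}$ and for every assignment), then the sequent $t\mid\Gamma\vdash\Delta$ is derivable in the sequent calculus described in the context.
   Context: Composition: $gf$ means first $f$, then $g$. A partial cartesian category is a locally posetal symmetric monoidal bicategory $\mathfrak{C}$ (hom-posets ordered by $\sqsubseteq$) such that every object $A$ has a unique cocommutative comonoid structure $\Delta_A:A\to A\otimes A$, $!_A:A\to I$, $\Delta$ strictly natural, $!$ lax natural ($!_Bf\sqsubseteq\,!_A$), and $\Delta_A$ has a right adjoint $\nabla_A$ with $\Delta_A\nabla_A=(\nabla_A\otimes\mathrm{id})(\mathrm{id}\otimes\Delta_A)$ and $\nabla_B(f\otimes g)\Delta_A\sqsubseteq f$. For $f:A\to B$, $\overline f:A\to A$ is $(\mathrm{id}\otimes(!_Bf))\Delta_A$ (using $A\otimes I\cong A$); $f$ is total if $\overline f=\mathrm{id}$. Functionally complete: every $d\sqsubseteq\mathrm{id}_A$ with $d^2=d$ is $ij$ with $i\dashv j$. Weak comma objects: for $f:A\to B$, $g:C\to B$ there are an object $f/g$ and total $\hat g:f/g\to A$, $\hat f:f/g\to C$ with $f\hat g\sqsubseteq g\hat f$ such that for $\phi:S\to A$, $\psi:S\to C$ with $f\phi\sqsubseteq g\psi$ there is a unique $\langle\phi,\psi\rangle:S\to f/g$ with $\hat g\langle\phi,\psi\rangle=\phi\overline\psi$,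 $\hat f\langle\phi,\psi\rangle=\psi\overline\phi$. Fix a functionally complete partial cartesian category $\mathfrak{C}$ with weak comma objects. Formulae (typed by objects of $\mathfrak{C}$): atomic formulae, each with a type; $\top:A$, $\bot:A$; if $P,Q:A$ then $\neg P,\ P\wedge Q,\ P\vee Q:A$; if $f:A\to B$ and $Q:B$ then $f^*Q:A$; if $f:A\to B$ and $P:A$ then $\coprod_fP:B$ and $\prod_fP:B$ (no rules specific to $\prod_f$ and no semantic clause for it are given). A sequent $A\mid\Gamma\vdash\Delta$ (type often omitted) consists of finite multisets $\Gamma,\Delta$ of formulae of type $A$. For $\Gamma$ on the left, $f^*\Gamma=\{f^*P:P\in\Gamma\}$; for $\Delta$ on the right, $f^*\Delta=\{f^*Q:Q\in\Delta\}$ if $\Delta\ne\emptyset$, and $f^*\Delta=\{f^*\bot\}$ if $\Delta=\emptyset$. Rules (premises $\Rightarrow$ conclusion; $f,g,\dots$ range over 1-cells of suitable type): Ax: $\Gamma,P\vdash\Delta,P$. Weakening: $\Gamma\vdash\Delta\Rightarrow\Gamma,P\vdash\Delta$; $\Gamma\vdash\Delta\Rightarrow\Gamma\vdash Q,\Delta$. Contraction: $\Gamma,P,P\vdash\Delta\Rightarrow\Gamma,P\vdash\Delta$; $\Gamma\vdash Q,Q,\Delta\Rightarrow\Gamma\vdash Q,\Delta$. $\bot$L: $\Gamma,\bot\vdash\Delta$. $\top$R: $\Gamma\vdash\top,\Delta$. $f^*\bot$L: $f^*\Gamma,\bot\vdash f^*\Delta$. $f^*\top$R: $\Gamma\vdash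 f^*\top,\Delta$. $\vee$L: $\Gamma,P_1\vdash\Delta$ and $\Gamma,P_2\vdash\Delta\Rightarrow\Gamma,P_1\vee P_2\vdash\Delta$. $\vee$R: $\Gamma\vdash\Delta,Q_1,Q_2\Rightarrow\Gamma\vdash\Delta,Q_1\vee Q_2$. $f^*\vee$L: $\Gamma,f^*P_1\vdash\Delta$ and $\Gamma,f^*P_2\vdash\Delta\Rightarrow\Gamma,f^*(P_1\vee P_2)\vdash\Delta$. $f^*\vee$R: $\Gamma\vdash\Delta,f^*Q_1,f^*Q_2\Rightarrow\Gamma\vdash\Delta,f^*(Q_1\vee Q_2)$. $\wedge$L: $\Gamma,P_1,P_2\vdash\Delta\Rightarrow\Gamma,P_1\wedge P_2\vdash\Delta$. $\wedge$R: $\Gamma\vdash Q_1,\Delta$ and $\Gamma\vdash Q_2,\Delta\Rightarrow\Gamma\vdash Q_1\wedge Q_2,\Delta$. $f^*\wedge$L: $\Gamma,f^*P_1,f^*P_2\vdash\Delta\Rightarrow\Gamma,f^*(P_1\wedge P_2)\vdash\Delta$. $f^*\wedge$R: $\Gamma\vdash f^*Q_1,\Delta$ and $\Gamma\vdash f^*Q_2,\Delta\Rightarrow\Gamma\vdash f^*(Q_1\wedge Q_2),\Delta$. $\neg$L: $\Gamma\vdash Q,\Delta\Rightarrow\Gamma,\neg Q\vdash\Delta$. $\neg$R: $\Gamma,Q\vdash\Delta\Rightarrow\Gamma\vdash\neg Q,\Delta$. $f^*\neg$L: $\Gamma,f^*\bot\vdash\Delta$ and $\Gamma\vdash f^*Q,\Delta\Rightarrow\Gamma,f^*(\neg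 Q)\vdash\Delta$. $f^*\neg$R: $\Gamma,f^*Q\vdash f^*\bot,\Delta\Rightarrow\Gamma\vdash f^*(\neg Q),\Delta$. Cut: $\Gamma\vdash f_1^*P,\Delta$ and $\Gamma',f_2^*P\vdash\Delta'$, with $f_2\sqsubseteq f_1$, $\Rightarrow\Gamma,\Gamma'\vdash\Delta,\Delta'$. $f^*$: $\Gamma\vdash\Delta\Rightarrow f^*\Gamma\vdash f^*\Delta$. $\coprod$L: for $f:A\to B$, $g:C\to B$, with $\hat g:f/g\to A$, $\hat f:f/g\to C$: $\hat g^*\Gamma,\hat f^*P\vdash\hat g^*\Delta\Rightarrow\Gamma,f^*(\coprod_gP)\vdash\Delta$. $\coprod$R: $\Gamma\vdash\tau^*Q,\Delta$, with $f\sqsubseteq g\tau$, $\Rightarrow\Gamma\vdash f^*\coprod_gQ,\Delta$. For $f\sqsubseteq g$: $\sqsubseteq$L: $\Gamma,f^*P\vdash\Delta\Rightarrow\Gamma,g^*P\vdash\Delta$; $\sqsubseteq$R: $\Gamma\vdash g^*Q,\Delta\Rightarrow\Gamma\vdash f^*Q,\Delta$; $\sqsubseteq$LR: $\Gamma,g^*\Gamma'\vdash g^*\Delta',\Delta\Rightarrow\Gamma,f^*\Gamma'\vdash f^*\Delta',\Delta$. $\circ$, $\circ^{-1}$: on either side, $f^*g^*P$ may be replaced by $(gf)^*P$, and conversely. $\mathrm{Id}$, $\mathrm{Id}^{-1}$: on either side, $P$ may be replaced by $\mathrm{id}^*P$, and conversely. Semantics. A model fibration over $\mathfrak{C}$ is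 a 2-fibration in Boolean algebras: Boolean algebras $\mathfrak{E}_A$ for objects $A$, and reindexing maps $f^*:\mathfrak{E}_B\to\mathfrak{E}_A$ for $f:A\to B$, which are monotone maps preserving $\top,\wedge,\vee$ (not necessarily $\bot$), strictly contravariantly functorial, with $g^*\le f^*$ pointwise whenever $f\sqsubseteq g$; each $f^*$ has a left adjoint $\coprod_f$, and the left adjoints satisfy Beck-Chevalley with respect to comma squares: $g^*\coprod_fP=\coprod_{\hat f}\hat g^*P$ for $f:A\to B$, $g:C\to B$ and $P\in\mathfrak{E}_A$, where $\hat g:f/g\to A$, $\hat f:f/g\to C$. An assignment chooses $[\![P]\!]_t\in\mathfrak{E}_t$ for each atomic $P:t$; this extends to formulae by the Boolean operations, the reindexing maps (for $f^*$) and their left adjoints (for $\coprod_f$). For contexts, $[\![\Gamma]\!]_t$ is the meet of the values of its members on the left ($\top$ if empty), and $[\![\Delta]\!]_t$ the join on the right ($\bot$ if empty).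
   Formalization: Beck-Chevalley is required for the comma square on g/f (2-cell g f̂ ⊑ f ĝ), not on f/g as written; the literal form forces f*=g* whenever f ⊑ g and makes completeness false. Formulae ∏_f P, which have no semantic clause, take arbitrary values. *)

theory Defs
  imports "HOL-Algebra.Lattice" "HOL-Library.Multiset"
begin

section \<open>Partial cartesian categories\<close>

text \<open>
  In a locally posetal bicategory invertible 2-cells are identities, so composition is strictly
  associative and unital, and the structural equivalences of a monoidal structure are
  isomorphisms satisfying the coherence laws as equations. \<open>g \<cdot> f\<close> is first \<open>f\<close>, then \<open>g\<close>.
\<close>

record ('o, 'm) pos_cat =
  Ob :: "'o set"
  Arr :: "'m set"
  src :: "'m \<Rightarrow> 'o"
  tgt :: "'m \<Rightarrow> 'o"
  ident :: "'o \<Rightarrow> 'm" ("\<one>\<index>")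
  comp :: "'m \<Rightarrow> 'm \<Rightarrow> 'm" (infixr "\<cdot>\<index>" 70)
  le2 :: "'m \<Rightarrow> 'm \<Rightarrow> bool" (infix "\<preceq>\<index>" 50)

definition homs :: "('o, 'm, 'x) pos_cat_scheme \<Rightarrow> 'o \<Rightarrow> 'o \<Rightarrow> 'm set" where
  "homs C A B = {f \<in> Arr C. src C f = A \<and> tgt C f = B}"

locale pos_category =
  fixes C :: "('o, 'm, 'x) pos_cat_scheme" (structure)
  assumes src_Ob: "f \<in> Arr C \<Longrightarrow> src C f \<in> Ob C"
    and tgt_Ob: "f \<in> Arr C \<Longrightarrow> tgt C f \<in> Ob C"
    and ident_hom: "A \<in> Ob C \<Longrightarrow> \<one> A \<in> homs C A A"
    and comp_hom: "\<lbrakk>f \<in> homs C A B; g \<in> homs C B D\<rbrakk> \<Longrightarrow> g \<cdot> f \<in> homs C A D"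
    and comp_ident_left: "f \<in> homs C A B \<Longrightarrow> \<one> B \<cdot> f = f"
    and comp_ident_right: "f \<in> homs C A B \<Longrightarrow> f \<cdot> \<one> A = f"
    and comp_assoc: "\<lbrakk>f \<in> homs C A B; g \<in> homs C B D; h \<in> homs C D E\<rbrakk>
                     \<Longrightarrow> (h \<cdot> g) \<cdot> f = h \<cdot> (g \<cdot> f)"
    and le2_parallel: "f \<preceq> g \<Longrightarrow> f \<in> Arr C \<and> g \<in> homs C (src C f) (tgt C f)"
    and le2_refl: "f \<in> Arr C \<Longrightarrow> f \<preceq> f"
    and le2_trans: "\<lbrakk>f \<preceq> g; g \<preceq> h\<rbrakk> \<Longrightarrow> f \<preceq> h"
    and le2_antisym: "\<lbrakk>f \<preceq> g; g \<preceq> f\<rbrakk> \<Longrightarrow> f = g"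
    and comp_mono: "\<lbrakk>f \<in> homs C A B; g \<in> homs C B D; f \<preceq> f'; g \<preceq> g'\<rbrakk>
                    \<Longrightarrow> g \<cdot> f \<preceq> g' \<cdot> f'"

definition inverse_arrows :: "('o, 'm, 'x) pos_cat_scheme \<Rightarrow> 'm \<Rightarrow> 'm \<Rightarrow> bool" where
  "inverse_arrows C f g \<longleftrightarrow>
     f \<in> Arr C \<and> g \<in> homs C (tgt C f) (src C f) \<and>
     g \<cdot>\<^bsub>C\<^esub> f = \<one>\<^bsub>C\<^esub> (src C f) \<and> f \<cdot>\<^bsub>C\<^esub> g = \<one>\<^bsub>C\<^esub> (tgt C f)"

definition left_adjoint_arrows :: "('o, 'm, 'x) pos_cat_scheme \<Rightarrow> 'm \<Rightarrow> 'm \<Rightarrow> bool" where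
  "left_adjoint_arrows C i j \<longleftrightarrow>
     i \<in> Arr C \<and> j \<in> homs C (tgt C i) (src C i) \<and>
     \<one>\<^bsub>C\<^esub> (src C i) \<preceq>\<^bsub>C\<^esub> j \<cdot>\<^bsub>C\<^esub> i \<and> i \<cdot>\<^bsub>C\<^esub> j \<preceq>\<^bsub>C\<^esub> \<one>\<^bsub>C\<^esub> (tgt C i)"

record ('o, 'm) sm_pos_cat = "('o, 'm) pos_cat" +
  tens_ob :: "'o \<Rightarrow> 'o \<Rightarrow> 'o" (infixr "\<odot>\<index>" 75)
  tens :: "'m \<Rightarrow> 'm \<Rightarrow> 'm" (infixr "\<otimes>\<index>" 75)
  unit_ob :: "'o" ("\<I>\<index>")
  assoc :: "'o \<Rightarrow> 'o \<Rightarrow> 'o \<Rightarrow> 'm" ("\<aa>\<index>")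
  assoc_inv :: "'o \<Rightarrow> 'o \<Rightarrow> 'o \<Rightarrow> 'm" ("\<aa>\<inverse>\<index>")
  lunit :: "'o \<Rightarrow> 'm" ("\<ll>\<index>")
  runit :: "'o \<Rightarrow> 'm" ("\<rr>\<index>")
  symm :: "'o \<Rightarrow> 'o \<Rightarrow> 'm" ("\<ss>\<index>")

locale sm_pos_category = pos_category C
  for C :: "('o, 'm, 'x) sm_pos_cat_scheme" (structure) +
  assumes tens_ob_Ob: "\<lbrakk>A \<in> Ob C; B \<in> Ob C\<rbrakk> \<Longrightarrow> A \<odot> B \<in> Ob C"
    and unit_Ob: "\<I> \<in> Ob C"
    and tens_hom: "\<lbrakk>f \<in> homs C A B; g \<in> homs C A' B'\<rbrakk> \<Longrightarrow> f \<otimes> g \<in> homs C (A \<odot> A') (B \<odot> B')"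
    and tens_ident: "\<lbrakk>A \<in> Ob C; B \<in> Ob C\<rbrakk> \<Longrightarrow> \<one> A \<otimes> \<one> B = \<one> (A \<odot> B)"
    and tens_comp: "\<lbrakk>f \<in> homs C A B; g \<in> homs C B D; f' \<in> homs C A' B'; g' \<in> homs C B' D'\<rbrakk>
                    \<Longrightarrow> (g \<cdot> f) \<otimes> (g' \<cdot> f') = (g \<otimes> g') \<cdot> (f \<otimes> f')"
    and tens_mono: "\<lbrakk>f \<preceq> g; f' \<preceq> g'\<rbrakk> \<Longrightarrow> f \<otimes> f' \<preceq> g \<otimes> g'"
    and assoc_hom: "\<lbrakk>A \<in> Ob C; B \<in> Ob C; D \<in> Ob C\<rbrakk>
                    \<Longrightarrow> \<aa> A B D \<in> homs C ((A \<odot> B) \<odot> D) (A \<odot> (B \<odot> D))"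
    and assoc_iso: "\<lbrakk>A \<in> Ob C; B \<in> Ob C; D \<in> Ob C\<rbrakk>
                    \<Longrightarrow> inverse_arrows C (\<aa> A B D) (\<aa>\<inverse> A B D)"
    and assoc_natural: "\<lbrakk>f \<in> homs C A A'; g \<in> homs C B B'; h \<in> homs C D D'\<rbrakk>
                    \<Longrightarrow> \<aa> A' B' D' \<cdot> ((f \<otimes> g) \<otimes> h) = (f \<otimes> (g \<otimes> h)) \<cdot> \<aa> A B D"
    and lunit_hom: "A \<in> Ob C \<Longrightarrow> \<ll> A \<in> homs C (\<I> \<odot> A) A"
    and lunit_iso: "A \<in> Ob C \<Longrightarrow> \<exists>g. inverse_arrows C (\<ll> A) g"
    and lunit_natural: "f \<in> homs C A B \<Longrightarrow> \<ll> B \<cdot> (\<one> \<I> \<otimes> f) = f \<cdot> \<ll> A"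
    and runit_hom: "A \<in> Ob C \<Longrightarrow> \<rr> A \<in> homs C (A \<odot> \<I>) A"
    and runit_iso: "A \<in> Ob C \<Longrightarrow> \<exists>g. inverse_arrows C (\<rr> A) g"
    and runit_natural: "f \<in> homs C A B \<Longrightarrow> \<rr> B \<cdot> (f \<otimes> \<one> \<I>) = f \<cdot> \<rr> A"
    and symm_hom: "\<lbrakk>A \<in> Ob C; B \<in> Ob C\<rbrakk> \<Longrightarrow> \<ss> A B \<in> homs C (A \<odot> B) (B \<odot> A)"
    and symm_natural: "\<lbrakk>f \<in> homs C A A'; g \<in> homs C B B'\<rbrakk>
                    \<Longrightarrow> \<ss> A' B' \<cdot> (f \<otimes> g) = (g \<otimes> f) \<cdot> \<ss> A B"
    and symm_symm: "\<lbrakk>A \<in> Ob C; B \<in> Ob C\<rbrakk> \<Longrightarrow> \<ss> B A \<cdot> \<ss> A B = \<one> (A \<odot> B)"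
    and pentagon: "\<lbrakk>A \<in> Ob C; B \<in> Ob C; D \<in> Ob C; E \<in> Ob C\<rbrakk>
                    \<Longrightarrow> (\<one> A \<otimes> \<aa> B D E) \<cdot> \<aa> A (B \<odot> D) E \<cdot> (\<aa> A B D \<otimes> \<one> E)
                        = \<aa> A B (D \<odot> E) \<cdot> \<aa> (A \<odot> B) D E"
    and triangle: "\<lbrakk>A \<in> Ob C; B \<in> Ob C\<rbrakk>
                    \<Longrightarrow> (\<one> A \<otimes> \<ll> B) \<cdot> \<aa> A \<I> B = \<rr> A \<otimes> \<one> B"
    and hexagon: "\<lbrakk>A \<in> Ob C; B \<in> Ob C; D \<in> Ob C\<rbrakk>
                    \<Longrightarrow> \<aa> B D A \<cdot> \<ss> A (B \<odot> D) \<cdot> \<aa> A B D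
                        = (\<one> B \<otimes> \<ss> A D) \<cdot> \<aa> B A D \<cdot> (\<ss> A B \<otimes> \<one> D)"

definition cocomm_comonoid :: "('o, 'm, 'x) sm_pos_cat_scheme \<Rightarrow> 'o \<Rightarrow> 'm \<Rightarrow> 'm \<Rightarrow> bool" where
  "cocomm_comonoid C A \<delta> \<epsilon> \<longleftrightarrow>
     \<delta> \<in> homs C A (A \<odot>\<^bsub>C\<^esub> A) \<and> \<epsilon> \<in> homs C A \<I>\<^bsub>C\<^esub> \<and>
     \<aa>\<^bsub>C\<^esub> A A A \<cdot>\<^bsub>C\<^esub> (\<delta> \<otimes>\<^bsub>C\<^esub> \<one>\<^bsub>C\<^esub> A) \<cdot>\<^bsub>C\<^esub> \<delta> = (\<one>\<^bsub>C\<^esub> A \<otimes>\<^bsub>C\<^esub> \<delta>) \<cdot>\<^bsub>C\<^esub> \<delta> \<and>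
     \<ll>\<^bsub>C\<^esub> A \<cdot>\<^bsub>C\<^esub> (\<epsilon> \<otimes>\<^bsub>C\<^esub> \<one>\<^bsub>C\<^esub> A) \<cdot>\<^bsub>C\<^esub> \<delta> = \<one>\<^bsub>C\<^esub> A \<and>
     \<rr>\<^bsub>C\<^esub> A \<cdot>\<^bsub>C\<^esub> (\<one>\<^bsub>C\<^esub> A \<otimes>\<^bsub>C\<^esub> \<epsilon>) \<cdot>\<^bsub>C\<^esub> \<delta> = \<one>\<^bsub>C\<^esub> A \<and>
     \<ss>\<^bsub>C\<^esub> A A \<cdot>\<^bsub>C\<^esub> \<delta> = \<delta>"

record ('o, 'm) pcart_cat = "('o, 'm) sm_pos_cat" +
  diag :: "'o \<Rightarrow> 'm" ("\<dd>\<index>")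
  bang :: "'o \<Rightarrow> 'm" ("\<ee>\<index>")
  codiag :: "'o \<Rightarrow> 'm" ("\<nabla>\<index>")

locale partial_cartesian_category = sm_pos_category C
  for C :: "('o, 'm, 'x) pcart_cat_scheme" (structure) +
  assumes diag_bang_comonoid: "A \<in> Ob C \<Longrightarrow> cocomm_comonoid C A (\<dd> A) (\<ee> A)"
    and comonoid_unique: "\<lbrakk>A \<in> Ob C; cocomm_comonoid C A \<delta> \<epsilon>\<rbrakk> \<Longrightarrow> \<delta> = \<dd> A \<and> \<epsilon> = \<ee> A"
    and diag_natural: "f \<in> homs C A B \<Longrightarrow> \<dd> B \<cdot> f = (f \<otimes> f) \<cdot> \<dd> A"
    and bang_lax_natural: "f \<in> homs C A B \<Longrightarrow> \<ee> B \<cdot> f \<preceq> \<ee> A"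
    and diag_adjoint: "A \<in> Ob C \<Longrightarrow> left_adjoint_arrows C (\<dd> A) (\<nabla> A)"
    and frobenius: "A \<in> Ob C \<Longrightarrow>
          \<dd> A \<cdot> \<nabla> A = (\<nabla> A \<otimes> \<one> A) \<cdot> \<aa>\<inverse> A A A \<cdot> (\<one> A \<otimes> \<dd> A)"
    and codiag_tens_diag_le: "\<lbrakk>f \<in> homs C A B; g \<in> homs C A B\<rbrakk>
          \<Longrightarrow> \<nabla> B \<cdot> (f \<otimes> g) \<cdot> \<dd> A \<preceq> f"

definition restr :: "('o, 'm, 'x) pcart_cat_scheme \<Rightarrow> 'm \<Rightarrow> 'm" where
  "restr C f = \<rr>\<^bsub>C\<^esub> (src C f) \<cdot>\<^bsub>C\<^esub>
     (\<one>\<^bsub>C\<^esub> (src C f) \<otimes>\<^bsub>C\<^esub> (\<ee>\<^bsub>C\<^esub> (tgt C f) \<cdot>\<^bsub>C\<^esub> f)) \<cdot>\<^bsub>C\<^esub> \<dd>\<^bsub>C\<^esub> (src C f)"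

definition total_arr :: "('o, 'm, 'x) pcart_cat_scheme \<Rightarrow> 'm \<Rightarrow> bool" where
  "total_arr C f \<longleftrightarrow> restr C f = \<one>\<^bsub>C\<^esub> (src C f)"

text \<open>
  \<open>comma f g\<close> is \<open>f/g\<close>; its projections \<open>cfst f g\<close> and \<open>csnd f g\<close> to the sources of \<open>f\<close> and \<open>g\<close>
  are the arrows written \<open>g\<close>-hat and \<open>f\<close>-hat. A choice of weak comma objects is part of the
  structure; by the universal property it is determined up to isomorphism.
\<close>

record ('o, 'm) comma_cat = "('o, 'm) pcart_cat" +
  comma :: "'m \<Rightarrow> 'm \<Rightarrow> 'o"
  cfst :: "'m \<Rightarrow> 'm \<Rightarrow> 'm"
  csnd :: "'m \<Rightarrow> 'm \<Rightarrow> 'm"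

locale fc_partial_cartesian_category_with_commas = partial_cartesian_category C
  for C :: "('o, 'm, 'x) comma_cat_scheme" (structure) +
  assumes functionally_complete: "\<lbrakk>A \<in> Ob C; d \<preceq> \<one> A; d \<cdot> d = d\<rbrakk>
          \<Longrightarrow> \<exists>S\<in>Ob C. \<exists>i\<in>homs C S A. \<exists>j\<in>homs C A S. left_adjoint_arrows C i j \<and> d = i \<cdot> j"
    and comma_Ob: "\<lbrakk>f \<in> homs C A B; g \<in> homs C D B\<rbrakk> \<Longrightarrow> comma C f g \<in> Ob C"
    and cfst_hom: "\<lbrakk>f \<in> homs C A B; g \<in> homs C D B\<rbrakk> \<Longrightarrow> cfst C f g \<in> homs C (comma C f g) A"
    and csnd_hom: "\<lbrakk>f \<in> homs C A B; g \<in> homs C D B\<rbrakk> \<Longrightarrow> csnd C f g \<in> homs C (comma C f g) D"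
    and cfst_total: "\<lbrakk>f \<in> homs C A B; g \<in> homs C D B\<rbrakk> \<Longrightarrow> total_arr C (cfst C f g)"
    and csnd_total: "\<lbrakk>f \<in> homs C A B; g \<in> homs C D B\<rbrakk> \<Longrightarrow> total_arr C (csnd C f g)"
    and comma_square: "\<lbrakk>f \<in> homs C A B; g \<in> homs C D B\<rbrakk>
          \<Longrightarrow> f \<cdot> cfst C f g \<preceq> g \<cdot> csnd C f g"
    and comma_universal: "\<lbrakk>f \<in> homs C A B; g \<in> homs C D B; \<phi> \<in> homs C S A; \<psi> \<in> homs C S D;
            f \<cdot> \<phi> \<preceq> g \<cdot> \<psi>\<rbrakk>
          \<Longrightarrow> \<exists>!u. u \<in> homs C S (comma C f g) \<and>
                cfst C f g \<cdot> u = \<phi> \<cdot> restr C \<psi> \<and> csnd C f g \<cdot> u = \<psi> \<cdot> restr C \<phi>"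


section \<open>Formulae and sequents\<close>

datatype ('o, 'm, 'p) fm =
    Atom 'p
  | Top 'o
  | Bot 'o
  | Neg "('o, 'm, 'p) fm"
  | And "('o, 'm, 'p) fm" "('o, 'm, 'p) fm"
  | Or "('o, 'm, 'p) fm" "('o, 'm, 'p) fm"
  | Pull 'm "('o, 'm, 'p) fm"
  | Coprod 'm "('o, 'm, 'p) fm"
  | Prod 'm "('o, 'm, 'p) fm"

text \<open>\<open>ty\<close> gives the types of the atomic formulae.\<close>

primrec has_type ::
  "('o, 'm, 'x) pos_cat_scheme \<Rightarrow> ('p \<Rightarrow> 'o) \<Rightarrow> ('o, 'm, 'p) fm \<Rightarrow> 'o \<Rightarrow> bool" where
  "has_type C ty (Atom p) A \<longleftrightarrow> A \<in> Ob C \<and> ty p = A"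
| "has_type C ty (Top B) A \<longleftrightarrow> A \<in> Ob C \<and> B = A"
| "has_type C ty (Bot B) A \<longleftrightarrow> A \<in> Ob C \<and> B = A"
| "has_type C ty (Neg P) A \<longleftrightarrow> has_type C ty P A"
| "has_type C ty (And P Q) A \<longleftrightarrow> has_type C ty P A \<and> has_type C ty Q A"
| "has_type C ty (Or P Q) A \<longleftrightarrow> has_type C ty P A \<and> has_type C ty Q A"
| "has_type C ty (Pull f Q) A \<longleftrightarrow> f \<in> Arr C \<and> src C f = A \<and> has_type C ty Q (tgt C f)"
| "has_type C ty (Coprod f P) B \<longleftrightarrow> f \<in> Arr C \<and> tgt C f = B \<and> has_type C ty P (src C f)"
| "has_type C ty (Prod f P) B \<longleftrightarrow> f \<in> Arr C \<and> tgt C f = B \<and> has_type C ty P (src C f)"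

definition is_context ::
  "('o, 'm, 'x) pos_cat_scheme \<Rightarrow> ('p \<Rightarrow> 'o) \<Rightarrow> 'o \<Rightarrow> ('o, 'm, 'p) fm multiset \<Rightarrow> bool" where
  "is_context C ty A \<Gamma> \<longleftrightarrow> A \<in> Ob C \<and> (\<forall>P\<in>#\<Gamma>. has_type C ty P A)"

definition is_sequent ::
  "('o, 'm, 'x) pos_cat_scheme \<Rightarrow> ('p \<Rightarrow> 'o) \<Rightarrow> 'o
     \<Rightarrow> ('o, 'm, 'p) fm multiset \<Rightarrow> ('o, 'm, 'p) fm multiset \<Rightarrow> bool" where
  "is_sequent C ty A \<Gamma> \<Delta> \<longleftrightarrow> is_context C ty A \<Gamma> \<and> is_context C ty A \<Delta>"

definition pullL :: "'m \<Rightarrow> ('o, 'm, 'p) fm multiset \<Rightarrow> ('o, 'm, 'p) fm multiset" where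
  "pullL f \<Gamma> = image_mset (Pull f) \<Gamma>"

definition pullR :: "('o, 'm, 'x) pos_cat_scheme \<Rightarrow> 'm
     \<Rightarrow> ('o, 'm, 'p) fm multiset \<Rightarrow> ('o, 'm, 'p) fm multiset" where
  "pullR C f \<Delta> = (if \<Delta> = {#} then {# Pull f (Bot (tgt C f)) #} else image_mset (Pull f) \<Delta>)"

text \<open>
  Every rule requires its conclusion to be a well-typed sequent; hence so are the premises,
  being derivable, and the 1-cells in a rule are of suitable type.
\<close>

inductive derivable ::
  "('o, 'm, 'x) comma_cat_scheme \<Rightarrow> ('p \<Rightarrow> 'o) \<Rightarrow> 'o
     \<Rightarrow> ('o, 'm, 'p) fm multiset \<Rightarrow> ('o, 'm, 'p) fm multiset \<Rightarrow> bool"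
  for C :: "('o, 'm, 'x) comma_cat_scheme" and ty :: "'p \<Rightarrow> 'o" where
  Ax: "is_sequent C ty A (\<Gamma> + {#P#}) (\<Delta> + {#P#})
       \<Longrightarrow> derivable C ty A (\<Gamma> + {#P#}) (\<Delta> + {#P#})"
| WeakL: "\<lbrakk>derivable C ty A \<Gamma> \<Delta>; is_sequent C ty A (\<Gamma> + {#P#}) \<Delta>\<rbrakk>
       \<Longrightarrow> derivable C ty A (\<Gamma> + {#P#}) \<Delta>"
| WeakR: "\<lbrakk>derivable C ty A \<Gamma> \<Delta>; is_sequent C ty A \<Gamma> (\<Delta> + {#Q#})\<rbrakk>
       \<Longrightarrow> derivable C ty A \<Gamma> (\<Delta> + {#Q#})"
| ContrL: "\<lbrakk>derivable C ty A (\<Gamma> + {#P, P#}) \<Delta>; is_sequent C ty A (\<Gamma> + {#P#}) \<Delta>\<rbrakk>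
       \<Longrightarrow> derivable C ty A (\<Gamma> + {#P#}) \<Delta>"
| ContrR: "\<lbrakk>derivable C ty A \<Gamma> (\<Delta> + {#Q, Q#}); is_sequent C ty A \<Gamma> (\<Delta> + {#Q#})\<rbrakk>
       \<Longrightarrow> derivable C ty A \<Gamma> (\<Delta> + {#Q#})"
| BotL: "is_sequent C ty A (\<Gamma> + {#Bot A#}) \<Delta>
       \<Longrightarrow> derivable C ty A (\<Gamma> + {#Bot A#}) \<Delta>"
| TopR: "is_sequent C ty A \<Gamma> (\<Delta> + {#Top A#})
       \<Longrightarrow> derivable C ty A \<Gamma> (\<Delta> + {#Top A#})"
| PullBotL: "\<lbrakk>f \<in> homs C A B; is_sequent C ty A (pullL f \<Gamma> + {#Bot A#}) (pullR C f \<Delta>)\<rbrakk>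
       \<Longrightarrow> derivable C ty A (pullL f \<Gamma> + {#Bot A#}) (pullR C f \<Delta>)"
| PullTopR: "\<lbrakk>f \<in> homs C A B; is_sequent C ty A \<Gamma> (\<Delta> + {#Pull f (Top B)#})\<rbrakk>
       \<Longrightarrow> derivable C ty A \<Gamma> (\<Delta> + {#Pull f (Top B)#})"
| OrL: "\<lbrakk>derivable C ty A (\<Gamma> + {#P1#}) \<Delta>; derivable C ty A (\<Gamma> + {#P2#}) \<Delta>;
         is_sequent C ty A (\<Gamma> + {#Or P1 P2#}) \<Delta>\<rbrakk>
       \<Longrightarrow> derivable C ty A (\<Gamma> + {#Or P1 P2#}) \<Delta>"
| OrR: "\<lbrakk>derivable C ty A \<Gamma> (\<Delta> + {#Q1, Q2#}); is_sequent C ty A \<Gamma> (\<Delta> + {#Or Q1 Q2#})\<rbrakk>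
       \<Longrightarrow> derivable C ty A \<Gamma> (\<Delta> + {#Or Q1 Q2#})"
| PullOrL: "\<lbrakk>derivable C ty A (\<Gamma> + {#Pull f P1#}) \<Delta>; derivable C ty A (\<Gamma> + {#Pull f P2#}) \<Delta>;
         is_sequent C ty A (\<Gamma> + {#Pull f (Or P1 P2)#}) \<Delta>\<rbrakk>
       \<Longrightarrow> derivable C ty A (\<Gamma> + {#Pull f (Or P1 P2)#}) \<Delta>"
| PullOrR: "\<lbrakk>derivable C ty A \<Gamma> (\<Delta> + {#Pull f Q1, Pull f Q2#});
         is_sequent C ty A \<Gamma> (\<Delta> + {#Pull f (Or Q1 Q2)#})\<rbrakk>
       \<Longrightarrow> derivable C ty A \<Gamma> (\<Delta> + {#Pull f (Or Q1 Q2)#})"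
| AndL: "\<lbrakk>derivable C ty A (\<Gamma> + {#P1, P2#}) \<Delta>; is_sequent C ty A (\<Gamma> + {#And P1 P2#}) \<Delta>\<rbrakk>
       \<Longrightarrow> derivable C ty A (\<Gamma> + {#And P1 P2#}) \<Delta>"
| AndR: "\<lbrakk>derivable C ty A \<Gamma> (\<Delta> + {#Q1#}); derivable C ty A \<Gamma> (\<Delta> + {#Q2#});
         is_sequent C ty A \<Gamma> (\<Delta> + {#And Q1 Q2#})\<rbrakk>
       \<Longrightarrow> derivable C ty A \<Gamma> (\<Delta> + {#And Q1 Q2#})"
| PullAndL: "\<lbrakk>derivable C ty A (\<Gamma> + {#Pull f P1, Pull f P2#}) \<Delta>;
         is_sequent C ty A (\<Gamma> + {#Pull f (And P1 P2)#}) \<Delta>\<rbrakk>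
       \<Longrightarrow> derivable C ty A (\<Gamma> + {#Pull f (And P1 P2)#}) \<Delta>"
| PullAndR: "\<lbrakk>derivable C ty A \<Gamma> (\<Delta> + {#Pull f Q1#}); derivable C ty A \<Gamma> (\<Delta> + {#Pull f Q2#});
         is_sequent C ty A \<Gamma> (\<Delta> + {#Pull f (And Q1 Q2)#})\<rbrakk>
       \<Longrightarrow> derivable C ty A \<Gamma> (\<Delta> + {#Pull f (And Q1 Q2)#})"
| NegL: "\<lbrakk>derivable C ty A \<Gamma> (\<Delta> + {#Q#}); is_sequent C ty A (\<Gamma> + {#Neg Q#}) \<Delta>\<rbrakk>
       \<Longrightarrow> derivable C ty A (\<Gamma> + {#Neg Q#}) \<Delta>"
| NegR: "\<lbrakk>derivable C ty A (\<Gamma> + {#Q#}) \<Delta>; is_sequent C ty A \<Gamma> (\<Delta> + {#Neg Q#})\<rbrakk>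
       \<Longrightarrow> derivable C ty A \<Gamma> (\<Delta> + {#Neg Q#})"
| PullNegL: "\<lbrakk>derivable C ty A (\<Gamma> + {#Pull f (Bot (tgt C f))#}) \<Delta>;
         derivable C ty A \<Gamma> (\<Delta> + {#Pull f Q#}); is_sequent C ty A (\<Gamma> + {#Pull f (Neg Q)#}) \<Delta>\<rbrakk>
       \<Longrightarrow> derivable C ty A (\<Gamma> + {#Pull f (Neg Q)#}) \<Delta>"
| PullNegR: "\<lbrakk>derivable C ty A (\<Gamma> + {#Pull f Q#}) (\<Delta> + {#Pull f (Bot (tgt C f))#});
         is_sequent C ty A \<Gamma> (\<Delta> + {#Pull f (Neg Q)#})\<rbrakk>
       \<Longrightarrow> derivable C ty A \<Gamma> (\<Delta> + {#Pull f (Neg Q)#})"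
| Cut: "\<lbrakk>derivable C ty A \<Gamma> (\<Delta> + {#Pull f1 P#}); derivable C ty A (\<Gamma>' + {#Pull f2 P#}) \<Delta>';
         f2 \<preceq>\<^bsub>C\<^esub> f1; is_sequent C ty A (\<Gamma> + \<Gamma>') (\<Delta> + \<Delta>')\<rbrakk>
       \<Longrightarrow> derivable C ty A (\<Gamma> + \<Gamma>') (\<Delta> + \<Delta>')"
| PullRule: "\<lbrakk>f \<in> homs C A B; derivable C ty B \<Gamma> \<Delta>; is_sequent C ty A (pullL f \<Gamma>) (pullR C f \<Delta>)\<rbrakk>
       \<Longrightarrow> derivable C ty A (pullL f \<Gamma>) (pullR C f \<Delta>)"
| CoprodL: "\<lbrakk>f \<in> homs C A B; g \<in> homs C D B;
         derivable C ty (comma C f g)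
           (pullL (cfst C f g) \<Gamma> + {#Pull (csnd C f g) P#}) (pullR C (cfst C f g) \<Delta>);
         is_sequent C ty A (\<Gamma> + {#Pull f (Coprod g P)#}) \<Delta>\<rbrakk>
       \<Longrightarrow> derivable C ty A (\<Gamma> + {#Pull f (Coprod g P)#}) \<Delta>"
| CoprodR: "\<lbrakk>f \<in> homs C A B; g \<in> homs C D B; \<tau> \<in> homs C A D; f \<preceq>\<^bsub>C\<^esub> g \<cdot>\<^bsub>C\<^esub> \<tau>;
         derivable C ty A \<Gamma> (\<Delta> + {#Pull \<tau> Q#});
         is_sequent C ty A \<Gamma> (\<Delta> + {#Pull f (Coprod g Q)#})\<rbrakk>
       \<Longrightarrow> derivable C ty A \<Gamma> (\<Delta> + {#Pull f (Coprod g Q)#})"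
| LeL: "\<lbrakk>f \<preceq>\<^bsub>C\<^esub> g; derivable C ty A (\<Gamma> + {#Pull f P#}) \<Delta>; is_sequent C ty A (\<Gamma> + {#Pull g P#}) \<Delta>\<rbrakk>
       \<Longrightarrow> derivable C ty A (\<Gamma> + {#Pull g P#}) \<Delta>"
| LeR: "\<lbrakk>f \<preceq>\<^bsub>C\<^esub> g; derivable C ty A \<Gamma> (\<Delta> + {#Pull g Q#}); is_sequent C ty A \<Gamma> (\<Delta> + {#Pull f Q#})\<rbrakk>
       \<Longrightarrow> derivable C ty A \<Gamma> (\<Delta> + {#Pull f Q#})"
| LeLR: "\<lbrakk>f \<preceq>\<^bsub>C\<^esub> g; derivable C ty A (\<Gamma> + pullL g \<Gamma>') (\<Delta> + pullR C g \<Delta>');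
         is_sequent C ty A (\<Gamma> + pullL f \<Gamma>') (\<Delta> + pullR C f \<Delta>')\<rbrakk>
       \<Longrightarrow> derivable C ty A (\<Gamma> + pullL f \<Gamma>') (\<Delta> + pullR C f \<Delta>')"
| CompL: "\<lbrakk>f \<in> homs C A B; g \<in> homs C B D; derivable C ty A (\<Gamma> + {#Pull f (Pull g P)#}) \<Delta>;
         is_sequent C ty A (\<Gamma> + {#Pull (g \<cdot>\<^bsub>C\<^esub> f) P#}) \<Delta>\<rbrakk>
       \<Longrightarrow> derivable C ty A (\<Gamma> + {#Pull (g \<cdot>\<^bsub>C\<^esub> f) P#}) \<Delta>"
| CompR: "\<lbrakk>f \<in> homs C A B; g \<in> homs C B D; derivable C ty A \<Gamma> (\<Delta> + {#Pull f (Pull g Q)#});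
         is_sequent C ty A \<Gamma> (\<Delta> + {#Pull (g \<cdot>\<^bsub>C\<^esub> f) Q#})\<rbrakk>
       \<Longrightarrow> derivable C ty A \<Gamma> (\<Delta> + {#Pull (g \<cdot>\<^bsub>C\<^esub> f) Q#})"
| CompInvL: "\<lbrakk>f \<in> homs C A B; g \<in> homs C B D; derivable C ty A (\<Gamma> + {#Pull (g \<cdot>\<^bsub>C\<^esub> f) P#}) \<Delta>;
         is_sequent C ty A (\<Gamma> + {#Pull f (Pull g P)#}) \<Delta>\<rbrakk>
       \<Longrightarrow> derivable C ty A (\<Gamma> + {#Pull f (Pull g P)#}) \<Delta>"
| CompInvR: "\<lbrakk>f \<in> homs C A B; g \<in> homs C B D; derivable C ty A \<Gamma> (\<Delta> + {#Pull (g \<cdot>\<^bsub>C\<^esub> f) Q#});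
         is_sequent C ty A \<Gamma> (\<Delta> + {#Pull f (Pull g Q)#})\<rbrakk>
       \<Longrightarrow> derivable C ty A \<Gamma> (\<Delta> + {#Pull f (Pull g Q)#})"
| IdL: "\<lbrakk>derivable C ty A (\<Gamma> + {#P#}) \<Delta>; is_sequent C ty A (\<Gamma> + {#Pull (\<one>\<^bsub>C\<^esub> A) P#}) \<Delta>\<rbrakk>
       \<Longrightarrow> derivable C ty A (\<Gamma> + {#Pull (\<one>\<^bsub>C\<^esub> A) P#}) \<Delta>"
| IdR: "\<lbrakk>derivable C ty A \<Gamma> (\<Delta> + {#Q#}); is_sequent C ty A \<Gamma> (\<Delta> + {#Pull (\<one>\<^bsub>C\<^esub> A) Q#})\<rbrakk>
       \<Longrightarrow> derivable C ty A \<Gamma> (\<Delta> + {#Pull (\<one>\<^bsub>C\<^esub> A) Q#})"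
| IdInvL: "\<lbrakk>derivable C ty A (\<Gamma> + {#Pull (\<one>\<^bsub>C\<^esub> A) P#}) \<Delta>; is_sequent C ty A (\<Gamma> + {#P#}) \<Delta>\<rbrakk>
       \<Longrightarrow> derivable C ty A (\<Gamma> + {#P#}) \<Delta>"
| IdInvR: "\<lbrakk>derivable C ty A \<Gamma> (\<Delta> + {#Pull (\<one>\<^bsub>C\<^esub> A) Q#}); is_sequent C ty A \<Gamma> (\<Delta> + {#Q#})\<rbrakk>
       \<Longrightarrow> derivable C ty A \<Gamma> (\<Delta> + {#Q#})"


section \<open>Model fibrations\<close>

locale boolean_algebra_on = bounded_lattice L
  for L :: "('e, 'x) gorder_scheme" (structure) +
  assumes distrib: "\<lbrakk>x \<in> carrier L; y \<in> carrier L; z \<in> carrier L\<rbrakk>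
                    \<Longrightarrow> x \<sqinter> (y \<squnion> z) = (x \<sqinter> y) \<squnion> (x \<sqinter> z)"
    and complemented: "x \<in> carrier L \<Longrightarrow> \<exists>y\<in>carrier L. x \<sqinter> y = \<bottom> \<and> x \<squnion> y = \<top>"

definition compl_on :: "('e, 'x) gorder_scheme \<Rightarrow> 'e \<Rightarrow> 'e" where
  "compl_on L x = (THE y. y \<in> carrier L \<and> x \<sqinter>\<^bsub>L\<^esub> y = \<bottom>\<^bsub>L\<^esub> \<and> x \<squnion>\<^bsub>L\<^esub> y = \<top>\<^bsub>L\<^esub>)"

record ('o, 'm, 'e) fibration =
  fibre :: "'o \<Rightarrow> 'e gorder"
  reindex :: "'m \<Rightarrow> 'e \<Rightarrow> 'e"
  image_along :: "'m \<Rightarrow> 'e \<Rightarrow> 'e"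

text \<open>
  In the Beck-Chevalley condition the comma square is the one with 2-cell
  \<open>g \<cdot> f-hat \<preceq> f \<cdot> g-hat\<close>, i.e. the one on \<open>g/f\<close>, as in the left rule for \<open>Coprod\<close>. Only this
  orientation has a canonical comparison \<open>image_along f-hat (reindex g-hat P) \<le> reindex g
  (image_along f P)\<close>; imposed on the square with the opposite 2-cell, the equation would force
  \<open>reindex f = reindex g\<close> whenever \<open>f \<preceq> g\<close>.
\<close>

locale model_fibration = fc_partial_cartesian_category_with_commas C
  for C :: "('o, 'm, 'x) comma_cat_scheme" (structure)
    and M :: "('o, 'm, 'e) fibration" +
  assumes fibre_boolean: "A \<in> Ob C \<Longrightarrow> boolean_algebra_on (fibre M A)"
    and reindex_closed: "\<lbrakk>f \<in> homs C A B; Q \<in> carrier (fibre M B)\<rbrakk>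
          \<Longrightarrow> reindex M f Q \<in> carrier (fibre M A)"
    and reindex_mono: "\<lbrakk>f \<in> homs C A B; Q \<in> carrier (fibre M B); R \<in> carrier (fibre M B);
            Q \<sqsubseteq>\<^bsub>fibre M B\<^esub> R\<rbrakk>
          \<Longrightarrow> reindex M f Q \<sqsubseteq>\<^bsub>fibre M A\<^esub> reindex M f R"
    and reindex_top: "f \<in> homs C A B \<Longrightarrow> reindex M f \<top>\<^bsub>fibre M B\<^esub> = \<top>\<^bsub>fibre M A\<^esub>"
    and reindex_meet: "\<lbrakk>f \<in> homs C A B; Q \<in> carrier (fibre M B); R \<in> carrier (fibre M B)\<rbrakk>
          \<Longrightarrow> reindex M f (Q \<sqinter>\<^bsub>fibre M B\<^esub> R) = reindex M f Q \<sqinter>\<^bsub>fibre M A\<^esub> reindex M f R"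
    and reindex_join: "\<lbrakk>f \<in> homs C A B; Q \<in> carrier (fibre M B); R \<in> carrier (fibre M B)\<rbrakk>
          \<Longrightarrow> reindex M f (Q \<squnion>\<^bsub>fibre M B\<^esub> R) = reindex M f Q \<squnion>\<^bsub>fibre M A\<^esub> reindex M f R"
    and reindex_ident: "\<lbrakk>A \<in> Ob C; Q \<in> carrier (fibre M A)\<rbrakk> \<Longrightarrow> reindex M (\<one> A) Q = Q"
    and reindex_comp: "\<lbrakk>f \<in> homs C A B; g \<in> homs C B D; Q \<in> carrier (fibre M D)\<rbrakk>
          \<Longrightarrow> reindex M (g \<cdot> f) Q = reindex M f (reindex M g Q)"
    and reindex_le2: "\<lbrakk>f \<in> homs C A B; f \<preceq> g; Q \<in> carrier (fibre M B)\<rbrakk>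
          \<Longrightarrow> reindex M g Q \<sqsubseteq>\<^bsub>fibre M A\<^esub> reindex M f Q"
    and image_closed: "\<lbrakk>f \<in> homs C A B; P \<in> carrier (fibre M A)\<rbrakk>
          \<Longrightarrow> image_along M f P \<in> carrier (fibre M B)"
    and image_adjoint: "\<lbrakk>f \<in> homs C A B; P \<in> carrier (fibre M A); Q \<in> carrier (fibre M B)\<rbrakk>
          \<Longrightarrow> image_along M f P \<sqsubseteq>\<^bsub>fibre M B\<^esub> Q \<longleftrightarrow> P \<sqsubseteq>\<^bsub>fibre M A\<^esub> reindex M f Q"
    and beck_chevalley: "\<lbrakk>f \<in> homs C A B; g \<in> homs C D B; P \<in> carrier (fibre M A)\<rbrakk>
          \<Longrightarrow> reindex M g (image_along M f P)
              = image_along M (cfst C g f) (reindex M (csnd C g f) P)"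

definition assignment ::
  "('o, 'm, 'x) pos_cat_scheme \<Rightarrow> ('p \<Rightarrow> 'o) \<Rightarrow> ('o, 'm, 'e) fibration \<Rightarrow> ('p \<Rightarrow> 'e) \<Rightarrow> bool" where
  "assignment C ty M v \<longleftrightarrow> (\<forall>p. ty p \<in> Ob C \<longrightarrow> v p \<in> carrier (fibre M (ty p)))"

text \<open>
  There is no semantic clause for \<open>Prod\<close>: the value \<open>w f P\<close> of \<open>Prod f P\<close> is an arbitrary element
  of the fibre over its type. The value of a formula without \<open>Prod\<close> does not depend on \<open>w\<close>.
\<close>

definition prod_values ::
  "('o, 'm, 'x) pos_cat_scheme \<Rightarrow> ('p \<Rightarrow> 'o) \<Rightarrow> ('o, 'm, 'e) fibration
     \<Rightarrow> ('m \<Rightarrow> ('o, 'm, 'p) fm \<Rightarrow> 'e) \<Rightarrow> bool" where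
  "prod_values C ty M w \<longleftrightarrow>
     (\<forall>f P B. has_type C ty (Prod f P) B \<longrightarrow> w f P \<in> carrier (fibre M B))"

primrec sem ::
  "('o, 'm, 'x) pos_cat_scheme \<Rightarrow> ('o, 'm, 'e) fibration \<Rightarrow> ('p \<Rightarrow> 'e)
     \<Rightarrow> ('m \<Rightarrow> ('o, 'm, 'p) fm \<Rightarrow> 'e) \<Rightarrow> ('o, 'm, 'p) fm \<Rightarrow> 'o \<Rightarrow> 'e" where
  "sem C M v w (Atom p) t = v p"
| "sem C M v w (Top A) t = \<top>\<^bsub>fibre M t\<^esub>"
| "sem C M v w (Bot A) t = \<bottom>\<^bsub>fibre M t\<^esub>"
| "sem C M v w (Neg P) t = compl_on (fibre M t) (sem C M v w P t)"
| "sem C M v w (And P Q) t = sem C M v w P t \<sqinter>\<^bsub>fibre M t\<^esub> sem C M v w Q t"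
| "sem C M v w (Or P Q) t = sem C M v w P t \<squnion>\<^bsub>fibre M t\<^esub> sem C M v w Q t"
| "sem C M v w (Pull f Q) t = reindex M f (sem C M v w Q (tgt C f))"
| "sem C M v w (Coprod f P) t = image_along M f (sem C M v w P (src C f))"
| "sem C M v w (Prod f P) t = w f P"

text \<open>Greatest lower and least upper bounds of finite sets; for empty contexts, top and bottom.\<close>

definition sem_left ::
  "('o, 'm, 'x) pos_cat_scheme \<Rightarrow> ('o, 'm, 'e) fibration \<Rightarrow> ('p \<Rightarrow> 'e)
     \<Rightarrow> ('m \<Rightarrow> ('o, 'm, 'p) fm \<Rightarrow> 'e) \<Rightarrow> ('o, 'm, 'p) fm multiset \<Rightarrow> 'o \<Rightarrow> 'e" where
  "sem_left C M v w \<Gamma> t = \<Sqinter>\<^bsub>fibre M t\<^esub> ((\<lambda>P. sem C M v w P t) ` set_mset \<Gamma>)"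

definition sem_right ::
  "('o, 'm, 'x) pos_cat_scheme \<Rightarrow> ('o, 'm, 'e) fibration \<Rightarrow> ('p \<Rightarrow> 'e)
     \<Rightarrow> ('m \<Rightarrow> ('o, 'm, 'p) fm \<Rightarrow> 'e) \<Rightarrow> ('o, 'm, 'p) fm multiset \<Rightarrow> 'o \<Rightarrow> 'e" where
  "sem_right C M v w \<Delta> t = \<Squnion>\<^bsub>fibre M t\<^esub> ((\<lambda>Q. sem C M v w Q t) ` set_mset \<Delta>)"

text \<open>
  Validity of a sequent in all model fibrations over \<open>C\<close> whose fibres have carriers in the type
  of sets of formulae.  Validity in all model fibrations whatsoever implies this, so completeness
  for this notion gives completeness for the semantics as a whole.
\<close>

definition valid_sequent ::
  "('o, 'm, 'x) comma_cat_scheme \<Rightarrow> ('p \<Rightarrow> 'o) \<Rightarrow> 'o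
     \<Rightarrow> ('o, 'm, 'p) fm multiset \<Rightarrow> ('o, 'm, 'p) fm multiset \<Rightarrow> bool" where
  "valid_sequent C ty t \<Gamma> \<Delta> \<longleftrightarrow>
     (\<forall>(M :: ('o, 'm, ('o, 'm, 'p) fm set) fibration) v w.
        model_fibration C M \<and> assignment C ty M v \<and> prod_values C ty M w \<longrightarrow>
        sem_left C M v w \<Gamma> t \<sqsubseteq>\<^bsub>fibre M t\<^esub> sem_right C M v w \<Delta> t)"

end

theory Submission
  imports Defs
begin

text \<open>
  The formulae of type \<open>A\<close>, ordered by derivability of the sequent from \<open>P\<close> to \<open>Q\<close>, form a Boolean
  algebra up to equivalence, and these Lindenbaum algebras make up a model fibration in which every
  formula denotes its own class; a sequent valid there is derivable by Cut. The right rule for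
  \<open>Coprod\<close> gives the unit of the adjunction between \<open>Coprod f\<close> and \<open>Pull f\<close>; the left rule at the
  comma object of an identity and \<open>f\<close> gives its universal property, and at a general comma object
  it gives Beck-Chevalley.
\<close>

section \<open>Uniqueness of bounds and of Boolean complements\<close>

lemma (in partial_order) some_greatest_eq: "greatest L x X \<Longrightarrow> (SOME y. greatest L y X) = x"
  by (rule some_equality) (simp, rule greatest_unique)

lemma (in partial_order) some_least_eq: "least L x X \<Longrightarrow> (SOME y. least L y X) = x"
  by (rule some_equality) (simp, rule least_unique)

text \<open>Distributivity splits \<open>y \<sqinter> (x \<squnion> z)\<close> into
  \<open>x \<sqinter> y\<close>, which vanishes, and \<open>y \<sqinter> z\<close>. Each of
  \<open>y\<close> and \<open>z\<close> is asked for only one half of being a complement of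
  \<open>x\<close>; applied in both directions, this makes complements unique.\<close>

lemma (in boolean_algebra_on) complement_le:
  assumes x: "x \<in> carrier L" and y: "y \<in> carrier L" and z: "z \<in> carrier L"
    and xy: "x \<sqinter> y = \<bottom>" and xz: "x \<squnion> z = \<top>"
  shows "y \<sqsubseteq> z"
proof -
  have yz: "y \<sqinter> z \<in> carrier L" "y \<sqinter> z \<sqsubseteq> z"
    using y z by (simp_all add: meet_right)
  have "y \<sqsubseteq> y \<sqinter> (x \<squnion> z)"
    unfolding xz using y by (intro meet_le) (simp_all add: top_higher)
  also have "y \<sqinter> (x \<squnion> z) = (x \<sqinter> y) \<squnion> (y \<sqinter> z)"
    using distrib[OF y x z] meet_comm[of L x y] by simp
  also have "\<dots> \<sqsubseteq> z"
    unfolding xy using z yz by (intro join_le) (simp_all add: bottom_lower)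
  finally show ?thesis
    using xy x y z yz by simp
qed

lemma (in boolean_algebra_on) compl_on_eqI:
  assumes "x \<in> carrier L" "y \<in> carrier L" "x \<sqinter> y = \<bottom>" "x \<squnion> y = \<top>"
  shows "compl_on L x = y"
  unfolding compl_on_def
proof (rule the_equality)
  show "y \<in> carrier L \<and> x \<sqinter> y = \<bottom> \<and> x \<squnion> y = \<top>"
    using assms by simp
  show "z = y" if "z \<in> carrier L \<and> x \<sqinter> z = \<bottom> \<and> x \<squnion> z = \<top>" for z
    using that assms complement_le[of x y z] complement_le[of x z y] by (intro le_antisym) simp_all
qed

section \<open>Typing and structural rules\<close>

locale sequent_calculus = fc_partial_cartesian_category_with_commas C
  for C :: "('o, 'm, 'x) comma_cat_scheme" (structure) +
  fixes ty :: "'p \<Rightarrow> 'o"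
begin

abbreviation typed :: "('o, 'm, 'p) fm \<Rightarrow> 'o \<Rightarrow> bool" where
  "typed \<equiv> has_type C ty"

abbreviation entails :: "'o \<Rightarrow> ('o, 'm, 'p) fm \<Rightarrow> ('o, 'm, 'p) fm \<Rightarrow> bool" where
  "entails A P Q \<equiv> derivable C ty A {#P#} {#Q#}"

lemma homsD: "f \<in> homs C A B \<Longrightarrow> f \<in> Arr C \<and> src C f = A \<and> tgt C f = B \<and> A \<in> Ob C \<and> B \<in> Ob C"
  using src_Ob tgt_Ob by (auto simp: homs_def)

lemma has_type_Ob: "typed P A \<Longrightarrow> A \<in> Ob C"
  by (induction P arbitrary: A) (auto intro: src_Ob tgt_Ob)

lemma typed_Pull: "f \<in> homs C A B \<Longrightarrow> typed (Pull f P) A \<longleftrightarrow> typed P B"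
  by (auto simp: homs_def)

lemma typed_Coprod: "f \<in> homs C A B \<Longrightarrow> typed (Coprod f P) B \<longleftrightarrow> typed P A"
  by (auto simp: homs_def)

lemma is_sequent_iff:
  "is_sequent C ty A \<Gamma> \<Delta> \<longleftrightarrow>
     A \<in> Ob C \<and> (\<forall>P\<in>#\<Gamma>. typed P A) \<and> (\<forall>P\<in>#\<Delta>. typed P A)"
  by (auto simp: is_sequent_def is_context_def)

text \<open>Every rule carries the well-typedness of its conclusion as a premise, so inspecting the
  last rule suffices.\<close>

lemma derivable_is_sequent: "derivable C ty A \<Gamma> \<Delta> \<Longrightarrow> is_sequent C ty A \<Gamma> \<Delta>"
  by (erule derivable.cases) simp_all

lemma entails_typed: "entails A P Q \<Longrightarrow> A \<in> Ob C \<and> typed P A \<and> typed Q A"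
  using derivable_is_sequent by (fastforce simp: is_sequent_iff)

lemma axiom: "\<lbrakk>is_sequent C ty A \<Gamma> \<Delta>; P \<in># \<Gamma>; P \<in># \<Delta>\<rbrakk> \<Longrightarrow> derivable C ty A \<Gamma> \<Delta>"
  using derivable.Ax[of C ty A "\<Gamma> - {#P#}" P "\<Delta> - {#P#}"] by simp

lemma entails_refl: "typed P A \<Longrightarrow> entails A P P"
  by (rule axiom) (auto simp: is_sequent_iff has_type_Ob)

lemma weaken_left: "\<lbrakk>derivable C ty A \<Gamma> \<Delta>; typed P A\<rbrakk> \<Longrightarrow> derivable C ty A (add_mset P \<Gamma>) \<Delta>"
  using derivable.WeakL[of C ty A \<Gamma> \<Delta> P] derivable_is_sequent[of A \<Gamma> \<Delta>]
  by (auto simp: is_sequent_iff)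

lemma weaken_right: "\<lbrakk>derivable C ty A \<Gamma> \<Delta>; typed P A\<rbrakk> \<Longrightarrow> derivable C ty A \<Gamma> (add_mset P \<Delta>)"
  using derivable.WeakR[of C ty A \<Gamma> \<Delta> P] derivable_is_sequent[of A \<Gamma> \<Delta>]
  by (auto simp: is_sequent_iff)

text \<open>The rule \<open>Cut\<close> eliminates only formulae under \<open>Pull\<close>.
  Prefixing \<open>Pull (\<one> A)\<close> on both sides by \<open>IdR\<close> and
  \<open>IdL\<close>, and taking both 1-cells to be the identity, gives cut for arbitrary
  formulae.\<close>

lemma cut:
  assumes "derivable C ty A \<Gamma> (add_mset P \<Delta>)" "derivable C ty A (add_mset P \<Gamma>') \<Delta>'"
  shows "derivable C ty A (\<Gamma> + \<Gamma>') (\<Delta> + \<Delta>')"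
proof -
  have ty: "A \<in> Ob C" "typed P A" "\<forall>P\<in>#\<Gamma>+\<Gamma>'. typed P A" "\<forall>P\<in>#\<Delta>+\<Delta>'. typed P A"
    using assms[THEN derivable_is_sequent] by (auto simp: is_sequent_iff)
  note I = ident_hom[OF ty(1)]
  have "derivable C ty A \<Gamma> (\<Delta> + {#Pull (\<one> A) P#})"
    using assms(1) ty homsD[OF I] by (intro derivable.IdR) (auto simp: is_sequent_iff)
  moreover have "derivable C ty A (\<Gamma>' + {#Pull (\<one> A) P#}) \<Delta>'"
    using assms(2) ty homsD[OF I] by (intro derivable.IdL) (auto simp: is_sequent_iff)
  ultimately show ?thesis
    using ty homsD[OF I] by (auto intro!: derivable.Cut le2_refl simp: is_sequent_iff)
qed

lemma entails_trans: "\<lbrakk>entails A P Q; entails A Q R\<rbrakk> \<Longrightarrow> entails A P R"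
  using cut[of A "{#P#}" Q "{#}" "{#}" "{#R#}"] by simp

section \<open>Propositional connectives as lattice operations\<close>

lemma entails_Top: "typed P A \<Longrightarrow> entails A P (Top A)"
  using derivable.TopR[of C ty A "{#P#}" "{#}"] by (auto simp: is_sequent_iff has_type_Ob)

lemma entails_Bot: "typed P A \<Longrightarrow> entails A (Bot A) P"
  using derivable.BotL[of C ty A "{#}" "{#P#}"] by (auto simp: is_sequent_iff has_type_Ob)

text \<open>\<open>AndR\<close> gives the pairing; the projections come from axioms through
  \<open>AndL\<close>, and transitivity does the rest. This universal property is the form in which
  \<open>meet_down\<close> identifies meets.\<close>

lemma entails_And_iff:
  assumes "typed P A" "typed Q A"
  shows "entails A R (And P Q) \<longleftrightarrow> entails A R P \<and> entails A R Q"
proof -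
  have "derivable C ty A {#P, Q#} {#P#}" "derivable C ty A {#P, Q#} {#Q#}"
    using assms axiom[of A "{#P, Q#}" "{#P#}" P] axiom[of A "{#P, Q#}" "{#Q#}" Q]
    by (auto simp: is_sequent_iff has_type_Ob)
  then have "entails A (And P Q) P" "entails A (And P Q) Q"
    using assms derivable.AndL[of C ty A "{#}" P Q]
    by (auto simp: is_sequent_iff has_type_Ob add_mset_commute)
  moreover have "entails A R (And P Q)" if "entails A R P" "entails A R Q"
    using assms that entails_typed[OF that(1)] derivable.AndR[of C ty A "{#R#}" "{#}" P Q]
    by (auto simp: is_sequent_iff)
  ultimately show ?thesis
    using entails_trans by blast
qed

lemma entails_Or_iff:
  assumes "typed P A" "typed Q A"
  shows "entails A (Or P Q) R \<longleftrightarrow> entails A P R \<and> entails A Q R"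
proof -
  have "derivable C ty A {#P#} {#P, Q#}" "derivable C ty A {#Q#} {#P, Q#}"
    using assms by (auto intro!: axiom simp: is_sequent_iff has_type_Ob)
  then have "entails A P (Or P Q)" "entails A Q (Or P Q)"
    using assms derivable.OrR[of C ty A _ "{#}" P Q]
    by (auto simp: is_sequent_iff has_type_Ob add_mset_commute)
  moreover have "entails A (Or P Q) R" if "entails A P R" "entails A Q R"
    using assms that entails_typed[OF that(1)] derivable.OrL[of C ty A "{#}" P "{#R#}" Q]
    by (auto simp: is_sequent_iff)
  ultimately show ?thesis
    using entails_trans by blast
qed

lemma And_entails: "\<lbrakk>typed P A; typed Q A\<rbrakk> \<Longrightarrow> entails A (And P Q) P \<and> entails A (And P Q) Q"
  using entails_And_iff[of P A Q "And P Q"] entails_refl[of "And P Q" A] by simp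

lemma entails_Or: "\<lbrakk>typed P A; typed Q A\<rbrakk> \<Longrightarrow> entails A P (Or P Q) \<and> entails A Q (Or P Q)"
  using entails_Or_iff[of P A Q "Or P Q"] entails_refl[of "Or P Q" A] by simp

lemma derivable_And_left:
  "derivable C ty A {#P, Q#} {#R#} \<Longrightarrow> entails A (And P Q) R"
  using derivable.AndL[of C ty A "{#}" P Q] derivable_is_sequent[of A "{#P, Q#}"]
  by (auto simp: is_sequent_iff add_mset_commute)

lemma derivable_Or_right:
  "derivable C ty A {#R#} {#P, Q#} \<Longrightarrow> entails A R (Or P Q)"
  using derivable.OrR[of C ty A "{#R#}" "{#}" P Q] derivable_is_sequent[of A "{#R#}"]
  by (auto simp: is_sequent_iff add_mset_commute)

text \<open>This half of distributivity can fail in a general lattice. It holds here because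
  \<open>OrL\<close> may act while the side formula \<open>P\<close> stays in the context.\<close>

lemma entails_distrib:
  assumes "typed P A" "typed Q A" "typed R A"
  shows "entails A (And P (Or Q R)) (Or (And P Q) (And P R))"
proof -
  have *: "derivable C ty A {#P, S#} {#Or (And P Q) (And P R)#}" if "S \<in> {Q, R}" for S
  proof -
    have "derivable C ty A {#P, S#} {#And P S#}"
      using assms that derivable.AndR[of C ty A "{#P, S#}" "{#}" P S]
        axiom[of A "{#P, S#}" "{#P#}" P] axiom[of A "{#P, S#}" "{#S#}" S]
      by (auto simp: is_sequent_iff has_type_Ob)
    moreover have "entails A (And P S) (Or (And P Q) (And P R))"
      using assms that entails_Or[of "And P Q" A "And P R"] by auto
    ultimately show ?thesis
      using cut[of A "{#P, S#}" "And P S" "{#}" "{#}"] by simp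
  qed
  have "derivable C ty A {#P, Or Q R#} {#Or (And P Q) (And P R)#}"
    using derivable.OrL[of C ty A "{#P#}" Q "{#Or (And P Q) (And P R)#}" R] *[of Q] *[of R] assms
    by (auto simp: is_sequent_iff has_type_Ob add_mset_commute)
  then show ?thesis
    by (rule derivable_And_left)
qed

lemma entails_contradiction: "typed P A \<Longrightarrow> entails A (And P (Neg P)) (Bot A)"
  using derivable.NegL[of C ty A "{#P#}" "{#Bot A#}" P] axiom[of A "{#P#}" "{#P, Bot A#}" P]
  by (intro derivable_And_left) (auto simp: is_sequent_iff has_type_Ob add_mset_commute)

lemma entails_excluded_middle: "typed P A \<Longrightarrow> entails A (Top A) (Or P (Neg P))"
  using derivable.NegR[of C ty A "{#Top A#}" P "{#P#}"] axiom[of A "{#P, Top A#}" "{#P#}" P]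
  by (intro derivable_Or_right) (auto simp: is_sequent_iff has_type_Ob add_mset_commute)

section \<open>Reindexing\<close>

lemma entails_Pull_mono:
  assumes "f \<in> homs C A B" "entails B P Q"
  shows "entails A (Pull f P) (Pull f Q)"
  \<comment> \<open>The succedent is nonempty, so \<open>pullR\<close> is plain
    \<open>Pull f\<close> and introduces no \<open>Bot\<close>.\<close>
  using derivable.PullRule[OF assms] entails_typed[OF assms(2)] homsD[OF assms(1)]
  by (auto simp: is_sequent_iff pullL_def pullR_def)

text \<open>For \<open>Top\<close>, and in the next two lemmas for \<open>And\<close> and
  \<open>Or\<close>, this is the half of preservation that needs a rule acting under
  \<open>Pull\<close>. The opposite halves follow from \<open>entails_Top\<close> and from
  monotonicity.\<close>

lemma entails_Pull_Top: "f \<in> homs C A B \<Longrightarrow> entails A (Top A) (Pull f (Top B))"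
  using derivable.PullTopR[of f C A B ty "{#Top A#}" "{#}"] homsD[of f A B]
  by (auto simp: is_sequent_iff)

lemma entails_Pull_And:
  assumes "f \<in> homs C A B" "typed P B" "typed Q B"
  shows "entails A (And (Pull f P) (Pull f Q)) (Pull f (And P Q))"
  using assms homsD[of f A B] And_entails[of "Pull f P" A "Pull f Q"]
    derivable.PullAndR[of C ty A "{#And (Pull f P) (Pull f Q)#}" "{#}" f P Q]
  by (auto simp: is_sequent_iff)

lemma entails_Pull_Or:
  assumes "f \<in> homs C A B" "typed P B" "typed Q B"
  shows "entails A (Pull f (Or P Q)) (Or (Pull f P) (Pull f Q))"
  using assms homsD[of f A B] entails_Or[of "Pull f P" A "Pull f Q"]
    derivable.PullOrL[of C ty A "{#}" f P "{#Or (Pull f P) (Pull f Q)#}" Q]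
  by (auto simp: is_sequent_iff)

lemma entails_Pull_ident:
  assumes "typed P A"
  shows "entails A (Pull (\<one> A) P) P" "entails A P (Pull (\<one> A) P)"
  using assms has_type_Ob[OF assms] homsD[OF ident_hom[OF has_type_Ob[OF assms]]]
    derivable.IdL[of C ty A "{#}" P "{#P#}"] derivable.IdR[of C ty A "{#P#}" "{#}" P]
    entails_refl[OF assms]
  by (auto simp: is_sequent_iff)

lemma entails_Pull_comp:
  assumes "f \<in> homs C A B" "g \<in> homs C B D" "typed P D"
  shows "entails A (Pull (g \<cdot> f) P) (Pull f (Pull g P))"
    and "entails A (Pull f (Pull g P)) (Pull (g \<cdot> f) P)"
proof -
  have ty: "typed (Pull (g \<cdot> f) P) A" "typed (Pull f (Pull g P)) A"
    using assms comp_hom[OF assms(1,2)] by (simp_all add: homs_def)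
  show "entails A (Pull (g \<cdot> f) P) (Pull f (Pull g P))"
    using derivable.CompL[OF assms(1,2), of ty "{#}" P] ty entails_refl[OF ty(2)]
    by (auto simp: is_sequent_iff has_type_Ob)
  show "entails A (Pull f (Pull g P)) (Pull (g \<cdot> f) P)"
    using derivable.CompR[OF assms(1,2), of ty _ "{#}" P] ty entails_refl[OF ty(2)]
    by (auto simp: is_sequent_iff has_type_Ob)
qed

text \<open>\<open>LeR\<close> passes from the larger to the smaller 1-cell on the right of an
  axiom, hence the reversal of order.\<close>

lemma entails_Pull_le2:
  assumes "f \<in> homs C A B" "f \<preceq> g" "typed P B"
  shows "entails A (Pull g P) (Pull f P)"
proof -
  have ty: "typed (Pull f P) A" "typed (Pull g P) A"
    using assms le2_parallel[OF assms(2)] by (auto simp: homs_def)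
  show ?thesis
    using derivable.LeR[OF assms(2), of ty A "{#Pull g P#}" "{#}" P] ty entails_refl[OF ty(2)]
    by (auto simp: is_sequent_iff has_type_Ob)
qed

section \<open>Images, their adjunction and Beck-Chevalley\<close>

lemma entails_Pull_Coprod:
  assumes "f \<in> homs C A B" "g \<in> homs C D B" "\<tau> \<in> homs C A D" "f \<preceq> g \<cdot> \<tau>" "typed P D"
  shows "entails A (Pull \<tau> P) (Pull f (Coprod g P))"
proof -
  have ty: "typed (Pull \<tau> P) A" "typed (Pull f (Coprod g P)) A"
    using assms by (auto simp: homs_def)
  show ?thesis
    using derivable.CoprodR[OF assms(1-4), of ty "{#Pull \<tau> P#}" "{#}" P] ty entails_refl[OF ty(1)]
    by (auto simp: is_sequent_iff has_type_Ob)
qed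

text \<open>This is \<open>CoprodL\<close> with no side formulae on the left and \<open>Q\<close>
  alone on the right: an entailment out of a reindexed image is tested on the comma object.\<close>

lemma Pull_Coprod_entails:
  assumes "f \<in> homs C A B" "g \<in> homs C D B"
    and "entails (comma C f g) (Pull (csnd C f g) P) (Pull (cfst C f g) Q)"
    and "typed Q A"
  shows "entails A (Pull f (Coprod g P)) Q"
proof -
  have "typed P D"
    using entails_typed[OF assms(3)] csnd_hom[OF assms(1,2)] by (auto simp: homs_def)
  then show ?thesis
    using derivable.CoprodL[OF assms(1,2), of ty "{#}" P "{#Q#}"] assms homsD[OF assms(1)]
      homsD[OF assms(2)]
    by (auto simp: is_sequent_iff pullL_def pullR_def)
qed

text \<open>In \<open>CoprodR\<close> both 1-cells are \<open>f\<close> and \<tau> is the identity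
  of \<open>A\<close>; the resulting \<open>Pull (\<one> A)\<close> is then removed.\<close>

lemma entails_unit:
  assumes "f \<in> homs C A B" "typed P A"
  shows "entails A P (Pull f (Coprod f P))"
proof -
  have "entails A (Pull (\<one> A) P) (Pull f (Coprod f P))"
    using assms homsD[OF assms(1)]
    by (intro entails_Pull_Coprod[of f A B]) (auto simp: ident_hom comp_ident_right le2_refl)
  then show ?thesis
    using entails_Pull_ident(2)[OF assms(2)] entails_trans by blast
qed

text \<open>From left to right, reindex along \<open>f\<close> and compose with the unit.
  Conversely, \<open>CoprodL\<close> acts only on an image under a \<open>Pull\<close>, so the
  identity of \<open>B\<close> is put in front and the comma object of that identity and
  \<open>f\<close> is used.\<close>

lemma Coprod_entails_iff:
  assumes f: "f \<in> homs C A B" and P: "typed P A" and Q: "typed Q B"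
  shows "entails B (Coprod f P) Q \<longleftrightarrow> entails A P (Pull f Q)"
proof
  assume "entails B (Coprod f P) Q"
  then show "entails A P (Pull f Q)"
    using entails_unit[OF f P] entails_Pull_mono[OF f] entails_trans by blast
next
  assume PQ: "entails A P (Pull f Q)"
  have B: "\<one> B \<in> homs C B B" using f homsD ident_hom by blast
  let ?p = "cfst C (\<one> B) f" and ?q = "csnd C (\<one> B) f" and ?K = "comma C (\<one> B) f"
  have p: "?p \<in> homs C ?K B" and q: "?q \<in> homs C ?K A"
    using cfst_hom[OF B f] csnd_hom[OF B f] by auto
  have le: "?p \<preceq> f \<cdot> ?q"
    using comma_square[OF B f] comp_ident_left[OF p] by simp
  \<comment> \<open>Reindex \<open>PQ\<close> along \<open>?q\<close>, compose the two reindexings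
    of \<open>Q\<close>, and use that reindexing reverses
    \<open>?p \<preceq> f \<cdot> ?q\<close>.\<close>
  have "entails ?K (Pull ?q P) (Pull ?p Q)"
    using entails_Pull_mono[OF q PQ] entails_Pull_comp(2)[OF q f Q] entails_Pull_le2[OF p le Q]
      entails_trans by blast
  then have "entails B (Pull (\<one> B) (Coprod f P)) Q"
    by (rule Pull_Coprod_entails[OF B f _ Q])
  moreover have "entails B (Coprod f P) (Pull (\<one> B) (Coprod f P))"
    using entails_Pull_ident(2) typed_Coprod[OF f] P by blast
  ultimately show "entails B (Coprod f P) Q"
    using entails_trans by blast
qed

text \<open>No rule applies \<open>Coprod\<close> to both sides at once, so monotonicity is drawn
  from the adjunction: \<open>P\<close> entails \<open>Q\<close>, and the unit takes
  \<open>Q\<close> further.\<close>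

lemma entails_Coprod_mono:
  assumes f: "f \<in> homs C A B" and "entails A P Q"
  shows "entails B (Coprod f P) (Coprod f Q)"
proof -
  have P: "typed P A" and Q: "typed Q A"
    using entails_typed[OF assms(2)] by auto
  have "entails A P (Pull f (Coprod f Q))"
    by (rule entails_trans[OF assms(2) entails_unit[OF f Q]])
  then show ?thesis
    using Coprod_entails_iff[OF f P] typed_Coprod[OF f] Q by blast
qed

text \<open>At the comma object of \<open>g\<close> and \<open>f\<close>, \<open>CoprodL\<close>
  reduces the first entailment to the unit for \<open>cfst C g f\<close>. The second, transposed
  along that projection, is \<open>CoprodR\<close> with \<open>csnd C g f\<close> as \<tau>; the
  comma square is its side condition.\<close>

lemma Beck_Chevalley_entails:
  assumes f: "f \<in> homs C A B" and g: "g \<in> homs C D B" and P: "typed P A"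
  shows "entails D (Pull g (Coprod f P)) (Coprod (cfst C g f) (Pull (csnd C g f) P))"
    and "entails D (Coprod (cfst C g f) (Pull (csnd C g f) P)) (Pull g (Coprod f P))"
proof -
  let ?p = "cfst C g f" and ?q = "csnd C g f" and ?K = "comma C g f"
  have p: "?p \<in> homs C ?K D" and q: "?q \<in> homs C ?K A"
    using cfst_hom[OF g f] csnd_hom[OF g f] by auto
  have qP: "typed (Pull ?q P) ?K" and T: "typed (Coprod f P) B"
    and gT: "typed (Pull g (Coprod f P)) D"
    using P typed_Pull[OF q] typed_Coprod[OF f] typed_Pull[OF g] by blast+
  show "entails D (Pull g (Coprod f P)) (Coprod ?p (Pull ?q P))"
    using entails_unit[OF p qP] typed_Coprod[OF p] qP by (blast intro: Pull_Coprod_entails[OF g f])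
  have "entails ?K (Pull ?q P) (Pull (g \<cdot> ?p) (Coprod f P))"
    by (rule entails_Pull_Coprod[OF comp_hom[OF p g] f q comma_square[OF g f] P])
  then show "entails D (Coprod ?p (Pull ?q P)) (Pull g (Coprod f P))"
    using entails_Pull_comp(1)[OF p g T] Coprod_entails_iff[OF p qP gT] entails_trans by blast
qed

section \<open>Finite contexts as single formulae\<close>

definition conj :: "'o \<Rightarrow> ('o, 'm, 'p) fm list \<Rightarrow> ('o, 'm, 'p) fm" where
  "conj A Ps = foldr And Ps (Top A)"

definition disj :: "'o \<Rightarrow> ('o, 'm, 'p) fm list \<Rightarrow> ('o, 'm, 'p) fm" where
  "disj A Ps = foldr Or Ps (Bot A)"

lemma typed_conj: "A \<in> Ob C \<Longrightarrow> typed (conj A Ps) A \<longleftrightarrow> (\<forall>P\<in>set Ps. typed P A)"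
  by (induction Ps) (auto simp: conj_def)

lemma typed_disj: "A \<in> Ob C \<Longrightarrow> typed (disj A Ps) A \<longleftrightarrow> (\<forall>P\<in>set Ps. typed P A)"
  by (induction Ps) (auto simp: disj_def)

lemma entails_conj_iff:
  assumes "typed R A" "\<forall>P\<in>set Ps. typed P A"
  shows "entails A R (conj A Ps) \<longleftrightarrow> (\<forall>P\<in>set Ps. entails A R P)"
  using assms(2)
proof (induction Ps)
  case Nil
  show ?case using entails_Top[OF assms(1)] by (simp add: conj_def)
next
  case (Cons P Ps)
  then show ?case
    using entails_And_iff[of P A "conj A Ps" R] typed_conj[OF has_type_Ob[OF assms(1)], of Ps]
    by (simp add: conj_def)
qed

lemma disj_entails_iff:
  assumes "typed R A" "\<forall>P\<in>set Ps. typed P A"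
  shows "entails A (disj A Ps) R \<longleftrightarrow> (\<forall>P\<in>set Ps. entails A P R)"
  using assms(2)
proof (induction Ps)
  case Nil
  show ?case using entails_Bot[OF assms(1)] by (simp add: disj_def)
next
  case (Cons P Ps)
  then show ?case
    using entails_Or_iff[of P A "disj A Ps" R] typed_disj[OF has_type_Ob[OF assms(1)], of Ps]
    by (simp add: disj_def)
qed

text \<open>Together with \<open>disj_entails_context\<close>, this lets two cuts turn an entailment
  from \<open>conj\<close> to \<open>disj\<close> into a sequent between contexts.\<close>

lemma context_entails_conj:
  assumes "A \<in> Ob C" "\<forall>P\<in>set Ps. typed P A"
  shows "derivable C ty A (mset Ps) {#conj A Ps#}"
  using assms(2)
proof (induction Ps)
  case Nil
  show ?case
    using derivable.TopR[of C ty A "{#}" "{#}"] assms(1) by (simp add: conj_def is_sequent_iff)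
next
  case (Cons P Ps)
  then have "derivable C ty A (mset (P # Ps)) {#P#}"
      "derivable C ty A (mset (P # Ps)) {#conj A Ps#}"
    using assms(1) axiom[of A "mset (P # Ps)" "{#P#}" P]
    by (auto simp: is_sequent_iff intro: weaken_left)
  then show ?case
    using derivable.AndR[of C ty A "mset (P # Ps)" "{#}" P "conj A Ps"] Cons.prems assms(1)
      typed_conj[OF assms(1), of Ps]
    by (simp add: is_sequent_iff conj_def)
qed

lemma disj_entails_context:
  assumes "A \<in> Ob C" "\<forall>P\<in>set Ps. typed P A"
  shows "derivable C ty A {#disj A Ps#} (mset Ps)"
  using assms(2)
proof (induction Ps)
  case Nil
  show ?case
    using derivable.BotL[of C ty A "{#}" "{#}"] assms(1) by (simp add: disj_def is_sequent_iff)
next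
  case (Cons P Ps)
  then have "derivable C ty A {#P#} (mset (P # Ps))"
      "derivable C ty A {#disj A Ps#} (mset (P # Ps))"
    using assms(1) axiom[of A "{#P#}" "mset (P # Ps)" P]
    by (auto simp: is_sequent_iff intro: weaken_right)
  then show ?case
    using derivable.OrL[of C ty A "{#}" P "mset (P # Ps)" "disj A Ps"] Cons.prems assms(1)
      typed_disj[OF assms(1), of Ps]
    by (simp add: is_sequent_iff disj_def)
qed

section \<open>Down-sets of formulae and the maps on them\<close>

text \<open>
  The class of a formula is represented by the principal down-set it generates: the order is then
  inclusion, and reindexing and images are unions over all members, without chosen representatives.
\<close>

definition down :: "'o \<Rightarrow> ('o, 'm, 'p) fm \<Rightarrow> ('o, 'm, 'p) fm set" where
  "down A P = {Q. entails A Q P}"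

definition lindenbaum_fibre :: "'o \<Rightarrow> ('o, 'm, 'p) fm set gorder" where
  "lindenbaum_fibre A = \<lparr>carrier = down A ` {P. typed P A}, eq = (=), le = (\<subseteq>)\<rparr>"

definition lindenbaum :: "('o, 'm, ('o, 'm, 'p) fm set) fibration" where
  "lindenbaum = \<lparr>fibre = lindenbaum_fibre,
     reindex = (\<lambda>f X. \<Union>P\<in>X. down (src C f) (Pull f P)),
     image_along = (\<lambda>f X. \<Union>P\<in>X. down (tgt C f) (Coprod f P))\<rparr>"

lemma lindenbaum_fibre_simps [simp]:
  "carrier (lindenbaum_fibre A) = down A ` {P. typed P A}"
  "x .=\<^bsub>lindenbaum_fibre A\<^esub> y \<longleftrightarrow> x = y"
  "x \<sqsubseteq>\<^bsub>lindenbaum_fibre A\<^esub> y \<longleftrightarrow> x \<subseteq> y"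
  by (simp_all add: lindenbaum_fibre_def)

text \<open>Inclusion gives entailment because a typed \<open>P\<close> lies in its own down-set; an
  ill-typed one would generate the empty set.\<close>

lemma down_subset_iff: "typed P A \<Longrightarrow> down A P \<subseteq> down A Q \<longleftrightarrow> entails A P Q"
  unfolding down_def using entails_refl[of P A] entails_trans by blast

lemma down_mono: "entails A P Q \<Longrightarrow> down A P \<subseteq> down A Q"
  unfolding down_def using entails_trans by blast

lemma down_eqI: "\<lbrakk>entails A P Q; entails A Q P\<rbrakk> \<Longrightarrow> down A P = down A Q"
  by (intro equalityI down_mono)

text \<open>By monotonicity every set in the union lies below the one contributed by
  \<open>P\<close> itself, so the union is again principal. \<open>image_down\<close> argues in the
  same way from \<open>entails_Coprod_mono\<close>.\<close>

lemma reindex_down: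
  assumes "f \<in> homs C A B" "typed P B"
  shows "reindex lindenbaum f (down B P) = down A (Pull f P)"
proof -
  have "down A (Pull f Q) \<subseteq> down A (Pull f P)" if "Q \<in> down B P" for Q
    using that entails_Pull_mono[OF assms(1)] by (intro down_mono) (simp add: down_def)
  moreover have "P \<in> down B P"
    using entails_refl[OF assms(2)] by (simp add: down_def)
  ultimately have "(\<Union>Q\<in>down B P. down A (Pull f Q)) = down A (Pull f P)"
    by blast
  then show ?thesis
    using homsD[OF assms(1)] by (simp add: lindenbaum_def)
qed

lemma image_down:
  assumes "f \<in> homs C A B" "typed P A"
  shows "image_along lindenbaum f (down A P) = down B (Coprod f P)"
proof -
  have "down B (Coprod f Q) \<subseteq> down B (Coprod f P)" if "Q \<in> down A P" for Q
    using that entails_Coprod_mono[OF assms(1)] by (intro down_mono) (simp add: down_def)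
  moreover have "P \<in> down A P"
    using entails_refl[OF assms(2)] by (simp add: down_def)
  ultimately have "(\<Union>Q\<in>down A P. down B (Coprod f Q)) = down B (Coprod f P)"
    by blast
  then show ?thesis
    using homsD[OF assms(1)] by (simp add: lindenbaum_def)
qed

lemma fibre_lindenbaum [simp]: "fibre lindenbaum = lindenbaum_fibre"
  by (simp add: lindenbaum_def)

section \<open>Boolean structure of the fibres\<close>

lemma lindenbaum_partial_order: "partial_order (lindenbaum_fibre A)"
  by unfold_locales (auto simp: fun_eq_iff)

text \<open>Testing against typed \<open>Q\<close> suffices, since their down-sets exhaust the
  carrier. With \<open>S\<close> arbitrary, possibly empty, one criterion covers binary meets and
  the values of whole contexts.\<close>

lemma greatest_down:
  assumes "typed R A" "\<And>P. P \<in> S \<Longrightarrow> typed P A"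
    and "\<And>Q. typed Q A \<Longrightarrow> entails A Q R \<longleftrightarrow> (\<forall>P\<in>S. entails A Q P)"
  shows "greatest (lindenbaum_fibre A) (down A R) (Lower (lindenbaum_fibre A) (down A ` S))"
proof (rule greatest_LowerI)
  fix x assume "x \<in> down A ` S"
  then obtain P where "x = down A P" "P \<in> S"
    by blast
  moreover from this have "entails A R P"
    using assms(1,3) entails_refl[of R A] by blast
  ultimately show "down A R \<sqsubseteq>\<^bsub>lindenbaum_fibre A\<^esub> x"
    by (simp add: down_mono)
next
  fix x assume x: "x \<in> Lower (lindenbaum_fibre A) (down A ` S)"
  then obtain Q where Q: "x = down A Q" "typed Q A"
    by (auto simp: Lower_def)
  have "entails A Q P" if "P \<in> S" for P
    using x that assms(2)[OF that] Q by (simp add: Lower_def flip: down_subset_iff)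
  then show "x \<sqsubseteq>\<^bsub>lindenbaum_fibre A\<^esub> down A R"
    using assms(1,3) Q by (simp add: down_subset_iff)
qed (use assms(1,2) in auto)

lemma least_down:
  assumes "typed R A" "\<And>P. P \<in> S \<Longrightarrow> typed P A"
    and "\<And>Q. typed Q A \<Longrightarrow> entails A R Q \<longleftrightarrow> (\<forall>P\<in>S. entails A P Q)"
  shows "least (lindenbaum_fibre A) (down A R) (Upper (lindenbaum_fibre A) (down A ` S))"
proof (rule least_UpperI)
  fix x assume "x \<in> down A ` S"
  then obtain P where "x = down A P" "P \<in> S"
    by blast
  moreover from this have "entails A P R"
    using assms(1,3) entails_refl[of R A] by blast
  ultimately show "x \<sqsubseteq>\<^bsub>lindenbaum_fibre A\<^esub> down A R"
    by (simp add: down_mono)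
next
  fix x assume x: "x \<in> Upper (lindenbaum_fibre A) (down A ` S)"
  then obtain Q where Q: "x = down A Q" "typed Q A"
    by (auto simp: Upper_def)
  have "entails A P Q" if "P \<in> S" for P
    using x that assms(2)[OF that] Q by (simp add: Upper_def flip: down_subset_iff)
  then show "down A R \<sqsubseteq>\<^bsub>lindenbaum_fibre A\<^esub> x"
    using assms(1,3) Q by (simp add: down_subset_iff)
qed (use assms(1,2) in auto)

text \<open>\<open>inf\<close> picks some greatest lower bound; antisymmetry leaves only one, so the
  pick is the bound found in \<open>greatest_down\<close>.\<close>

lemma inf_down:
  assumes "typed R A" "\<And>P. P \<in> S \<Longrightarrow> typed P A"
    and "\<And>Q. typed Q A \<Longrightarrow> entails A Q R \<longleftrightarrow> (\<forall>P\<in>S. entails A Q P)"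
  shows "\<Sqinter>\<^bsub>lindenbaum_fibre A\<^esub> (down A ` S) = down A R"
  unfolding inf_def
  by (rule partial_order.some_greatest_eq[OF lindenbaum_partial_order greatest_down[OF assms]])

lemma sup_down:
  assumes "typed R A" "\<And>P. P \<in> S \<Longrightarrow> typed P A"
    and "\<And>Q. typed Q A \<Longrightarrow> entails A R Q \<longleftrightarrow> (\<forall>P\<in>S. entails A P Q)"
  shows "\<Squnion>\<^bsub>lindenbaum_fibre A\<^esub> (down A ` S) = down A R"
  unfolding sup_def
  by (rule partial_order.some_least_eq[OF lindenbaum_partial_order least_down[OF assms]])

lemma meet_down:
  "\<lbrakk>typed P A; typed Q A\<rbrakk> \<Longrightarrow> down A P \<sqinter>\<^bsub>lindenbaum_fibre A\<^esub> down A Q = down A (And P Q)"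
  using inf_down[of "And P Q" A "{P, Q}"] by (auto simp: meet_def entails_And_iff)

lemma join_down:
  "\<lbrakk>typed P A; typed Q A\<rbrakk> \<Longrightarrow> down A P \<squnion>\<^bsub>lindenbaum_fibre A\<^esub> down A Q = down A (Or P Q)"
  using sup_down[of "Or P Q" A "{P, Q}"] by (auto simp: join_def entails_Or_iff)

lemma greatest_Top:
  "A \<in> Ob C \<Longrightarrow>
     greatest (lindenbaum_fibre A) (down A (Top A)) (carrier (lindenbaum_fibre A))"
  by (auto simp: greatest_def down_subset_iff entails_Top)

lemma least_Bot:
  "A \<in> Ob C \<Longrightarrow>
     least (lindenbaum_fibre A) (down A (Bot A)) (carrier (lindenbaum_fibre A))"
  by (auto simp: least_def down_subset_iff entails_Bot)

lemma top_down: "A \<in> Ob C \<Longrightarrow> \<top>\<^bsub>lindenbaum_fibre A\<^esub> = down A (Top A)"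
  unfolding top_def
  by (rule partial_order.some_greatest_eq[OF lindenbaum_partial_order greatest_Top])

lemma bottom_down: "A \<in> Ob C \<Longrightarrow> \<bottom>\<^bsub>lindenbaum_fibre A\<^esub> = down A (Bot A)"
  unfolding bottom_def
  by (rule partial_order.some_least_eq[OF lindenbaum_partial_order least_Bot])

lemma meet_Neg_down:
  assumes "typed P A"
  shows "down A P \<sqinter>\<^bsub>lindenbaum_fibre A\<^esub> down A (Neg P) = \<bottom>\<^bsub>lindenbaum_fibre A\<^esub>"
  using assms has_type_Ob[OF assms] entails_contradiction[OF assms]
  by (auto simp: meet_down bottom_down intro!: down_eqI entails_Bot)

lemma join_Neg_down:
  assumes "typed P A"
  shows "down A P \<squnion>\<^bsub>lindenbaum_fibre A\<^esub> down A (Neg P) = \<top>\<^bsub>lindenbaum_fibre A\<^esub>"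
  using assms has_type_Ob[OF assms] entails_excluded_middle[OF assms]
  by (auto simp: join_down top_down intro!: down_eqI entails_Top)

lemma lindenbaum_boolean:
  assumes "A \<in> Ob C"
  shows "boolean_algebra_on (lindenbaum_fibre A)"
proof -
  interpret partial_order "lindenbaum_fibre A"
    by (rule lindenbaum_partial_order)
  show ?thesis
  proof
    fix x y assume "x \<in> carrier (lindenbaum_fibre A)" "y \<in> carrier (lindenbaum_fibre A)"
    then obtain P Q where P: "x = down A P" "typed P A" and Q: "y = down A Q" "typed Q A"
      by auto
    show "\<exists>s. least (lindenbaum_fibre A) s (Upper (lindenbaum_fibre A) {x, y})"
      using least_down[of "Or P Q" A "{P, Q}"] P Q by (auto simp: entails_Or_iff)
    show "\<exists>s. greatest (lindenbaum_fibre A) s (Lower (lindenbaum_fibre A) {x, y})"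
      using greatest_down[of "And P Q" A "{P, Q}"] P Q by (auto simp: entails_And_iff)
  next
    show "\<exists>x. least (lindenbaum_fibre A) x (carrier (lindenbaum_fibre A))"
      using least_Bot[OF assms] by blast
    show "\<exists>x. greatest (lindenbaum_fibre A) x (carrier (lindenbaum_fibre A))"
      using greatest_Top[OF assms] by blast
  next
    fix x y z
    assume "x \<in> carrier (lindenbaum_fibre A)" "y \<in> carrier (lindenbaum_fibre A)"
      "z \<in> carrier (lindenbaum_fibre A)"
    then obtain P Q R where P: "x = down A P" "typed P A" and Q: "y = down A Q" "typed Q A"
      and R: "z = down A R" "typed R A"
      by auto
    \<comment> \<open>This direction holds in every lattice; the other is
      \<open>entails_distrib\<close>.\<close>
    have "entails A (Or (And P Q) (And P R)) (And P (Or Q R))"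
      using P Q R And_entails[of P A Q] And_entails[of P A R] entails_Or[of Q A R] entails_trans
      by (simp add: entails_And_iff entails_Or_iff) blast
    then show "x \<sqinter>\<^bsub>lindenbaum_fibre A\<^esub> (y \<squnion>\<^bsub>lindenbaum_fibre A\<^esub> z) =
        x \<sqinter>\<^bsub>lindenbaum_fibre A\<^esub> y \<squnion>\<^bsub>lindenbaum_fibre A\<^esub> (x \<sqinter>\<^bsub>lindenbaum_fibre A\<^esub> z)"
      using P Q R entails_distrib[of P A Q R] by (auto simp: meet_down join_down intro!: down_eqI)
  next
    fix x assume "x \<in> carrier (lindenbaum_fibre A)"
    then obtain P where P: "x = down A P" "typed P A"
      by auto
    then show "\<exists>y\<in>carrier (lindenbaum_fibre A). x \<sqinter>\<^bsub>lindenbaum_fibre A\<^esub> y = \<bottom>\<^bsub>lindenbaum_fibre A\<^esub> \<and>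
        x \<squnion>\<^bsub>lindenbaum_fibre A\<^esub> y = \<top>\<^bsub>lindenbaum_fibre A\<^esub>"
      by (intro bexI[of _ "down A (Neg P)"]) (auto simp: meet_Neg_down join_Neg_down)
  qed
qed

text \<open>\<open>compl_on\<close> is a definite description, so its value rests on the uniqueness
  of complements in a Boolean algebra.\<close>

lemma compl_down: "typed P A \<Longrightarrow> compl_on (lindenbaum_fibre A) (down A P) = down A (Neg P)"
  by (intro boolean_algebra_on.compl_on_eqI lindenbaum_boolean meet_Neg_down join_Neg_down)
    (auto simp: has_type_Ob)

section \<open>The fibration axioms for the Lindenbaum algebras\<close>

lemma lindenbaum_model: "model_fibration C lindenbaum"
proof (intro model_fibration.intro model_fibration_axioms.intro)
  show "fc_partial_cartesian_category_with_commas C"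
    by unfold_locales
next
  show "boolean_algebra_on (fibre lindenbaum A)" if "A \<in> Ob C" for A
    using lindenbaum_boolean[OF that] by simp
next
  fix f A B Q assume f: "f \<in> homs C A B" and "Q \<in> carrier (fibre lindenbaum B)"
  then obtain P where P: "Q = down B P" "typed P B" by auto
  then show "reindex lindenbaum f Q \<in> carrier (fibre lindenbaum A)"
    using f typed_Pull[OF f] by (auto simp: reindex_down)
  fix R assume "R \<in> carrier (fibre lindenbaum B)"
  then obtain P' where P': "R = down B P'" "typed P' B" by auto
  have ty: "typed (Pull f P) A" "typed (Pull f P') A" "typed (And P P') B" "typed (Or P P') B"
    using P P' typed_Pull[OF f] by auto
  show "reindex lindenbaum f Q \<sqsubseteq>\<^bsub>fibre lindenbaum A\<^esub> reindex lindenbaum f R"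
    if "Q \<sqsubseteq>\<^bsub>fibre lindenbaum B\<^esub> R"
    using that P P' entails_Pull_mono[OF f] ty by (simp add: reindex_down[OF f] down_subset_iff)
  \<comment> \<open>Monotonicity gives this half and \<open>PullAndR\<close> the other; joins are
    treated dually below.\<close>
  have "entails A (Pull f (And P P')) (And (Pull f P) (Pull f P'))"
    using entails_And_iff[OF ty(1,2)] entails_Pull_mono[OF f] And_entails[OF P(2) P'(2)] by blast
  from down_eqI[OF this entails_Pull_And[OF f P(2) P'(2)]]
  show "reindex lindenbaum f (Q \<sqinter>\<^bsub>fibre lindenbaum B\<^esub> R) =
      reindex lindenbaum f Q \<sqinter>\<^bsub>fibre lindenbaum A\<^esub> reindex lindenbaum f R"
    using P P' ty
    by (simp add: meet_down reindex_down[OF f] del: has_type.simps)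
  have "entails A (Or (Pull f P) (Pull f P')) (Pull f (Or P P'))"
    using entails_Or_iff[OF ty(1,2)] entails_Pull_mono[OF f] entails_Or[OF P(2) P'(2)] by blast
  from down_eqI[OF entails_Pull_Or[OF f P(2) P'(2)] this]
  show "reindex lindenbaum f (Q \<squnion>\<^bsub>fibre lindenbaum B\<^esub> R) =
      reindex lindenbaum f Q \<squnion>\<^bsub>fibre lindenbaum A\<^esub> reindex lindenbaum f R"
    using P P' ty
    by (simp add: join_down reindex_down[OF f] del: has_type.simps)
next
  fix f A B assume f: "f \<in> homs C A B"
  then show "reindex lindenbaum f \<top>\<^bsub>fibre lindenbaum B\<^esub> = \<top>\<^bsub>fibre lindenbaum A\<^esub>"
    using homsD[OF f] entails_Pull_Top[OF f] entails_Top[of "Pull f (Top B)" A]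
    by (auto simp: top_down reindex_down[OF f] intro!: down_eqI)
next
  fix A Q assume A: "A \<in> Ob C" and "Q \<in> carrier (fibre lindenbaum A)"
  then obtain P where P: "Q = down A P" "typed P A" by auto
  then show "reindex lindenbaum (\<one> A) Q = Q"
    using down_eqI[OF entails_Pull_ident[OF P(2)]] by (simp add: reindex_down[OF ident_hom[OF A]])
next
  fix f A B g D Q
  assume f: "f \<in> homs C A B" and g: "g \<in> homs C B D" and "Q \<in> carrier (fibre lindenbaum D)"
  then obtain P where P: "Q = down D P" "typed P D" by auto
  then show "reindex lindenbaum (g \<cdot> f) Q = reindex lindenbaum f (reindex lindenbaum g Q)"
    using typed_Pull[OF g] down_eqI[OF entails_Pull_comp[OF f g P(2)]]
    by (simp add: reindex_down[OF f] reindex_down[OF g] reindex_down[OF comp_hom[OF f g]]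
        del: has_type.simps)
next
  fix f A B g Q
  assume f: "f \<in> homs C A B" and fg: "f \<preceq> g" and "Q \<in> carrier (fibre lindenbaum B)"
  then obtain P where P: "Q = down B P" "typed P B" by auto
  have g: "g \<in> homs C A B"
    using le2_parallel[OF fg] f by (simp add: homs_def)
  show "reindex lindenbaum g Q \<sqsubseteq>\<^bsub>fibre lindenbaum A\<^esub> reindex lindenbaum f Q"
    using P typed_Pull[OF g] entails_Pull_le2[OF f fg]
    by (simp add: reindex_down[OF f] reindex_down[OF g] down_subset_iff del: has_type.simps)
next
  fix f A B R assume f: "f \<in> homs C A B" and "R \<in> carrier (fibre lindenbaum A)"
  then obtain P where P: "R = down A P" "typed P A" by auto
  then show "image_along lindenbaum f R \<in> carrier (fibre lindenbaum B)"
    using typed_Coprod[OF f] by (auto simp: image_down[OF f])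
  fix Q assume "Q \<in> carrier (fibre lindenbaum B)"
  then obtain P' where P': "Q = down B P'" "typed P' B" by auto
  show "image_along lindenbaum f R \<sqsubseteq>\<^bsub>fibre lindenbaum B\<^esub> Q \<longleftrightarrow>
      R \<sqsubseteq>\<^bsub>fibre lindenbaum A\<^esub> reindex lindenbaum f Q"
    using P P' typed_Coprod[OF f] Coprod_entails_iff[OF f]
    by (simp add: reindex_down[OF f] image_down[OF f] down_subset_iff del: has_type.simps)
next
  fix f A B g D R
  assume f: "f \<in> homs C A B" and g: "g \<in> homs C D B" and "R \<in> carrier (fibre lindenbaum A)"
  then obtain P where P: "R = down A P" "typed P A" by auto
  have *: "typed (Coprod f P) B" "typed (Pull (csnd C g f) P) (comma C g f)"
    using P typed_Coprod[OF f] typed_Pull[OF csnd_hom[OF g f]] by auto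
  \<comment> \<open>On generators all four maps are computed by \<open>Pull\<close> and
    \<open>Coprod\<close>, which leaves the two entailments of
    \<open>Beck_Chevalley_entails\<close>.\<close>
  show "reindex lindenbaum g (image_along lindenbaum f R) =
      image_along lindenbaum (cfst C g f) (reindex lindenbaum (csnd C g f) R)"
    using P * down_eqI[OF Beck_Chevalley_entails[OF f g P(2)]]
    by (simp add: reindex_down[OF g] image_down[OF f] reindex_down[OF csnd_hom[OF g f]]
        image_down[OF cfst_hom[OF g f]] del: has_type.simps)
qed

section \<open>Canonical interpretation and completeness\<close>

abbreviation canonical_sem :: "('o, 'm, 'p) fm \<Rightarrow> 'o \<Rightarrow> ('o, 'm, 'p) fm set" where
  "canonical_sem \<equiv>
     sem C lindenbaum (\<lambda>p. down (ty p) (Atom p)) (\<lambda>f P. down (tgt C f) (Prod f P))"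

text \<open>Atoms denote their own classes by choice of assignment. So does each
  \<open>Prod f P\<close>, since its value may be chosen freely for the formula as a whole. The type
  is generalized because \<open>Pull\<close> and \<open>Coprod\<close> change it.\<close>

lemma canonical_sem_eq_down: "typed P A \<Longrightarrow> canonical_sem P A = down A P"
proof (induction P arbitrary: A)
  case (Pull f P)
  then show ?case
    using reindex_down[of f A "tgt C f" P] by (simp add: homs_def)
next
  case (Coprod f P)
  then show ?case
    using image_down[of f "src C f" A P] by (simp add: homs_def)
qed (auto simp: top_down bottom_down compl_down meet_down join_down)

lemma completeness:
  assumes "is_context C ty t \<Gamma>" "is_context C ty t \<Delta>" "valid_sequent C ty t \<Gamma> \<Delta>"
  shows "derivable C ty t \<Gamma> \<Delta>"
proof -
  \<comment> \<open>Any enumeration will do: by \<open>entails_conj_iff\<close> and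
    \<open>disj_entails_iff\<close>, reordering changes \<open>conj\<close> and \<open>disj\<close>
    only up to equivalence.\<close>
  obtain Ps Qs where Ps: "\<Gamma> = mset Ps" and Qs: "\<Delta> = mset Qs"
    using ex_mset by metis
  have t: "t \<in> Ob C" and tyP: "\<forall>P\<in>set Ps. typed P t" and tyQ: "\<forall>Q\<in>set Qs. typed Q t"
    using assms(1,2) by (auto simp: is_context_def Ps Qs)
  let ?v = "\<lambda>p. down (ty p) (Atom p)" and ?w = "\<lambda>f P. down (tgt C f) (Prod f P)"
  \<comment> \<open>The type of \<open>Prod f P\<close> is \<open>tgt C f\<close>, so
    \<open>?w\<close> takes its values in the right fibres.\<close>
  have "assignment C ty lindenbaum ?v" "prod_values C ty lindenbaum ?w"
    by (auto simp: assignment_def prod_values_def)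
  with lindenbaum_model assms(3)
  have "sem_left C lindenbaum ?v ?w \<Gamma> t \<sqsubseteq>\<^bsub>fibre lindenbaum t\<^esub> sem_right C lindenbaum ?v ?w \<Delta> t"
    unfolding valid_sequent_def by blast
  then have "sem_left C lindenbaum ?v ?w \<Gamma> t \<subseteq> sem_right C lindenbaum ?v ?w \<Delta> t"
    by simp
  moreover have "sem_left C lindenbaum ?v ?w \<Gamma> t = \<Sqinter>\<^bsub>lindenbaum_fibre t\<^esub> (down t ` set Ps)"
    using tyP by (simp add: sem_left_def Ps canonical_sem_eq_down cong: image_cong)
  \<comment> \<open>For an empty context both sides are the class of \<open>Top t\<close>.\<close>
  moreover have "\<dots> = down t (conj t Ps)"
    using t tyP by (intro inf_down) (auto simp: typed_conj entails_conj_iff)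
  moreover have "sem_right C lindenbaum ?v ?w \<Delta> t = \<Squnion>\<^bsub>lindenbaum_fibre t\<^esub> (down t ` set Qs)"
    using tyQ by (simp add: sem_right_def Qs canonical_sem_eq_down cong: image_cong)
  moreover have "\<dots> = down t (disj t Qs)"
    using t tyQ by (intro sup_down) (auto simp: typed_disj disj_entails_iff)
  ultimately have "entails t (conj t Ps) (disj t Qs)"
    using t tyP by (simp add: down_subset_iff typed_conj)
  \<comment> \<open>The first cut replaces \<open>conj t Ps\<close> by the context on the left, the
    second replaces \<open>disj t Qs\<close> by the one on the right.\<close>
  then have "derivable C ty t \<Gamma> {#disj t Qs#}"
    using cut[of t \<Gamma> "conj t Ps" "{#}" "{#}"] context_entails_conj[OF t tyP] by (simp add: Ps)
  then show ?thesis
    using cut[of t \<Gamma> "disj t Qs" "{#}" "{#}" \<Delta>] disj_entails_context[OF t tyQ] by (simp add: Qs)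
qed

end

theorem theorem10:
  fixes C :: "('o, 'm) comma_cat"
    and ty :: "'p \<Rightarrow> 'o"
    and t :: 'o
    and \<Gamma> \<Delta> :: "('o, 'm, 'p) fm multiset"
  assumes "fc_partial_cartesian_category_with_commas C"
    and "t \<in> Ob C"
    and "is_context C ty t \<Gamma>"
    and "is_context C ty t \<Delta>"
    and "valid_sequent C ty t \<Gamma> \<Delta>"
  shows "derivable C ty t \<Gamma> \<Delta>"
  using assms by (intro sequent_calculus.completeness sequent_calculus.intro)

end
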